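(* For all $s\in(0,1]$ and all $u\in(0,s)$ there exists a compact set $X_{u,s}\subseteq\mathbb{R}^2$ with $\dim_{\mathrm H} X_{u,s}=s$ such that $$\dim_{\mathrm H}\{V\in G(2,1) : \dim_{\mathrm H} P_V(X_{u,s})\le u\}=\max\{0,\,2u-s\}.$$
   Context: $G(2,1)$ is the Grassmannian of lines through the origin in $\mathbb{R}^2$, with its usual metric (e.g. $\|P_V-P_W\|$), with respect to which Hausdorff dimensions of subsets of $G(2,1)$ are taken. $P_V:\mathbb{R}^2\to V$ is orthogonal projection onto $V$, and $V$ is identified with $\mathbb{R}$. $\dim_{\mathrm H}$ denotes Hausdorff dimension, with $\dim_{\mathrm H}\varnothing=0$. *)

theory Defs
  imports "HOL-Analysis.Analysis"
begin

section \<open>Hausdorff measure and dimension\<close>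

text \<open>
  The contribution \<open>diam(U)^t\<close> of a bounded covering set. For \<open>t = 0\<close> the usual convention
  \<open>0^0 = 1\<close> is used for non-empty sets (whereas \<open>0 powr 0 = 0\<close> in HOL), so that the
  0-dimensional measure is counting measure; the empty set contributes \<open>0\<close> for every \<open>t\<close>.
\<close>

definition diam_power :: "real \<Rightarrow> 'a::metric_space set \<Rightarrow> ennreal" where
  "diam_power t U =
     (if U = {} then 0 else if t = 0 then 1 else ennreal (diameter U powr t))"

text \<open>
  Boundedness of the covering sets is required explicitly because \<open>diameter\<close> is real-valued and
  carries no meaning on unbounded sets. Finite covers are included by padding with \<open>{}\<close>.
\<close>

definition hausdorff_pre_measure :: "real \<Rightarrow> real \<Rightarrow> 'a::metric_space set \<Rightarrow> ennreal" where
  "hausdorff_pre_measure t \<delta> A =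
     (INF U \<in> {U :: nat \<Rightarrow> 'a set.
                 A \<subseteq> (\<Union>i. U i) \<and> (\<forall>i. bounded (U i) \<and> diameter (U i) \<le> \<delta>)}.
        \<Sum>i. diam_power t (U i))"

definition hausdorff_measure :: "real \<Rightarrow> 'a::metric_space set \<Rightarrow> ennreal" where
  "hausdorff_measure t A = (SUP \<delta> \<in> {0<..}. hausdorff_pre_measure t \<delta> A)"

text \<open>
  The infimum ranges over \<open>t \<ge> 0\<close>, so \<open>hausdorff_dim {} = 0\<close>. The value is \<open>\<infinity>\<close> if no
  Hausdorff measure of the set vanishes.
\<close>

definition hausdorff_dim :: "'a::metric_space set \<Rightarrow> ennreal" where
  "hausdorff_dim A = (INF t \<in> {t. 0 \<le> t \<and> hausdorff_measure t A = 0}. ennreal t)"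

lemma hausdorff_dim_empty: "hausdorff_dim ({} :: 'a::metric_space set) = 0"
proof -
  have "hausdorff_pre_measure 0 \<delta> ({} :: 'a set) = 0" if "\<delta> > 0" for \<delta>
  proof -
    have "hausdorff_pre_measure 0 \<delta> ({} :: 'a set) \<le> (\<Sum>i::nat. diam_power 0 ({} :: 'a set))"
      unfolding hausdorff_pre_measure_def
      by (rule INF_lower2[where i = "\<lambda>_. {}"]) (use that in auto)
    then show ?thesis
      by (simp add: diam_power_def)
  qed
  then have "hausdorff_measure 0 ({} :: 'a set) = 0"
    by (simp add: hausdorff_measure_def)
  then have "hausdorff_dim ({} :: 'a set) \<le> ennreal 0"
    unfolding hausdorff_dim_def by (intro INF_lower) auto
  then show ?thesis by simp
qed


section \<open>Orthogonal projection onto a subspace\<close>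

definition orth_proj :: "'a::euclidean_space set \<Rightarrow> 'a \<Rightarrow> 'a" where
  "orth_proj V x = (THE y. y \<in> V \<and> (\<forall>v\<in>V. orthogonal (x - y) v))"

lemma orth_proj_ex1:
  fixes V :: "'a::euclidean_space set"
  assumes "subspace V"
  shows "\<exists>!y. y \<in> V \<and> (\<forall>v\<in>V. orthogonal (x - y) v)"
proof -
  obtain y z where yz: "y \<in> span V" "\<And>w. w \<in> span V \<Longrightarrow> orthogonal z w" "x = y + z"
    using orthogonal_subspace_decomp_exists[of V x] by metis
  have sp: "span V = V"
    using assms by (simp add: span_eq_iff)
  show ?thesis
  proof (rule ex1I[of _ y])
    show "y \<in> V \<and> (\<forall>v\<in>V. orthogonal (x - y) v)"
      using yz sp by auto
  next
    fix y' assume y': "y' \<in> V \<and> (\<forall>v\<in>V. orthogonal (x - y') v)"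
    have mem: "y' - y \<in> V"
      using y' yz sp assms by (simp add: subspace_diff)
    have "(x - y') \<bullet> (y' - y) = 0" "(x - y) \<bullet> (y' - y) = 0"
      using y' yz sp mem by (auto simp: orthogonal_def)
    then have "(y' - y) \<bullet> (y' - y) = 0"
      by (simp add: inner_diff_left)
    then show "y' = y" by simp
  qed
qed

lemma orth_proj_in: "subspace V \<Longrightarrow> orth_proj V x \<in> V"
  and orth_proj_orthogonal: "subspace V \<Longrightarrow> v \<in> V \<Longrightarrow> orthogonal (x - orth_proj V x) v"
  using theI'[OF orth_proj_ex1, of V x] unfolding orth_proj_def by auto

lemma orth_proj_eqI:
  assumes "subspace V" "y \<in> V" "\<And>v. v \<in> V \<Longrightarrow> orthogonal (x - y) v"
  shows "orth_proj V x = y"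
  unfolding orth_proj_def using assms by (intro the1_equality orth_proj_ex1) auto

lemma orth_proj_id: "subspace V \<Longrightarrow> x \<in> V \<Longrightarrow> orth_proj V x = x"
  by (rule orth_proj_eqI) (auto simp: orthogonal_def)

lemma bounded_linear_orth_proj:
  assumes "subspace V"
  shows "bounded_linear (orth_proj V)"
proof -
  have "linear (orth_proj V)"
  proof (rule linearI)
    fix x y :: 'a and c :: real
    note orth = orth_proj_orthogonal[OF assms, unfolded orthogonal_def]
    show "orth_proj V (x + y) = orth_proj V x + orth_proj V y"
    proof (rule orth_proj_eqI[OF assms])
      show "orth_proj V x + orth_proj V y \<in> V"
        by (intro subspace_add assms orth_proj_in)
      fix v assume "v \<in> V"
      then show "orthogonal (x + y - (orth_proj V x + orth_proj V y)) v"
        using orth[of v x] orth[of v y]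
        by (simp add: orthogonal_def inner_diff_left inner_add_left)
    qed
    show "orth_proj V (c *\<^sub>R x) = c *\<^sub>R orth_proj V x"
    proof (rule orth_proj_eqI[OF assms])
      show "c *\<^sub>R orth_proj V x \<in> V"
        by (intro subspace_scale assms orth_proj_in)
      fix v assume "v \<in> V"
      then show "orthogonal (c *\<^sub>R x - c *\<^sub>R orth_proj V x) v"
        using orth[of v x] by (simp add: orthogonal_def inner_diff_left)
    qed
  qed
  then show ?thesis by (rule linear_conv_bounded_linear[THEN iffD1])
qed


section \<open>The Grassmannian of lines in the plane\<close>

typedef G21 = "{V :: (real^2) set. subspace V \<and> dim V = 1}"
  morphisms line_of Abs_G21
proof -
  have "subspace (span {axis 1 1 :: real^2})" "dim (span {axis 1 1 :: real^2}) = 1"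
    by (simp_all add: subspace_span dim_span dim_singleton axis_eq_0_iff)
  then show ?thesis by blast
qed

text \<open>The projection has values in \<open>V \<subseteq> \<real>\<^sup>2\<close>; identifying \<open>V\<close> with \<open>\<real>\<close> is an isometry, hence
  immaterial for Hausdorff dimension.\<close>

definition proj_line :: "G21 \<Rightarrow> real^2 \<Rightarrow> real^2" where
  "proj_line V = orth_proj (line_of V)"

lemma subspace_line_of [simp]: "subspace (line_of V)"
  using line_of[of V] by simp

lemma bounded_linear_proj_line: "bounded_linear (proj_line V)"
  unfolding proj_line_def by (simp add: bounded_linear_orth_proj)

lemma range_proj_line: "range (proj_line V) = line_of V"
  unfolding proj_line_def by (auto simp: orth_proj_in image_iff) (metis orth_proj_id subspace_line_of)

instantiation G21 :: metric_space
begin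

definition dist_G21 :: "G21 \<Rightarrow> G21 \<Rightarrow> real" where
  "dist_G21 V W = onorm (\<lambda>x. proj_line V x - proj_line W x)"

definition uniformity_G21 :: "(G21 \<times> G21) filter" where
  "uniformity_G21 = (INF e\<in>{0<..}. principal {(V, W). dist V W < e})"

definition open_G21 :: "G21 set \<Rightarrow> bool" where
  "open_G21 S \<longleftrightarrow> (\<forall>V\<in>S. \<forall>\<^sub>F (V', W) in uniformity. V' = V \<longrightarrow> W \<in> S)"

instance
proof
  fix V W Z :: G21
  have bl: "bounded_linear (\<lambda>x. proj_line V x - proj_line W x)" for V W
    by (intro bounded_linear_sub bounded_linear_proj_line)
  show "dist V W = 0 \<longleftrightarrow> V = W"
  proof
    assume "dist V W = 0"
    then have "proj_line V x = proj_line W x" for x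
      using onorm_eq_0[OF bl, of V W] by (simp add: dist_G21_def)
    then have "proj_line V = proj_line W" by blast
    then have "line_of V = line_of W"
      using range_proj_line by metis
    then show "V = W" by (simp add: line_of_inject)
  next
    assume "V = W"
    then show "dist V W = 0" by (simp add: dist_G21_def onorm_zero)
  qed
  have sym: "dist W Z = dist Z W"
    using onorm_neg[of "\<lambda>x. proj_line Z x - proj_line W x"] by (simp add: dist_G21_def)
  show "dist V W \<le> dist V Z + dist W Z"
    using onorm_triangle[OF bl[of V Z] bl[of Z W]] sym by (simp add: dist_G21_def)
qed (rule uniformity_G21_def open_G21_def)+

end

end

theory Submission
  imports Defs
begin

text \<open>
  Fix a rapidly increasing sequence \<open>m j\<close> and put \<open>\<delta> = 2 ^ (- m j)\<close>. At scale \<open>\<delta>\<close> the set \<open>X\<close> is a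
  product of two grids with spacings \<open>2 ^ (- a j)\<close> and \<open>2 ^ (- b j)\<close>, approximately \<open>\<delta> ^ u\<close> and
  \<open>\<delta> ^ (s - u)\<close>, so that \<open>X\<close> has dimension \<open>s\<close>. If \<open>\<theta>\<close> is \<open>\<delta>\<close>-close to a multiple of \<open>2 ^ (- g j)\<close> with
  \<open>g = a - b\<close>, the projection \<open>(x, y) \<mapsto> x + \<theta> y\<close> maps the grid close to \<open>2 ^ (- a j) \<int>\<close>, i.e. to
  about \<open>\<delta> ^ (- u)\<close> intervals of length \<open>\<delta>\<close>. Slopes for which this happens at every scale form a
  set of dimension \<open>2 u - s\<close>.

  Conversely, if the projection is significantly more concentrated than dimension \<open>u + \<epsilon>\<close> allows, then
  some strip of width slightly larger than \<open>\<delta>\<close> contains almost as many grid points as there are values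
  of \<open>y\<close>. Two such coincidences at a short and at a long distance force \<open>2 ^ g j \<theta>\<close> to be very close to
  a fraction \<open>p / q\<close> with a small denominator \<open>q\<close>, and the slopes for which this happens infinitely often
  are covered by few short intervals.
\<close>


section \<open>Hausdorff dimension\<close>

text \<open>The growth of \<open>m\<close> makes the exponents exact: level j retains at least 2 ^
  (a j - m (j - 1)) grid points in the first factor, and a loss of m (j - 1) in the exponent is
  negligible against m j.

  The converse rests on integrality. Let \<theta>' be the rescaled slope. If p + q \<theta>' and e +
  D \<theta>' both have modulus at most \<rho>, then the integer p D - e q has modulus at most
  \<rho> (q + D). Once this is below 1 it vanishes, the two fractions agree, and the short
  difference q provides the small denominator while the long difference D provides the accuracy
  \<rho> / D. The full range of y may be too long for this, so it is cut into windows; a + b \<le> m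
  keeps their number down to a power of 2 ^ e, where e is about \<kappa> m. All losses
  (denominators, strip widths, number of windows) are such powers, so they change exponents by
  O(\<kappa>) only, and \<kappa> is chosen last, depending on how far t exceeds 2 u - s.

  No limit measure is constructed: lower bounds come from Frostman-type estimates for counts on
  finite grids.\<close>

lemma hausdorff_measure_mono:
  assumes "A \<subseteq> B"
  shows "hausdorff_measure t A \<le> hausdorff_measure t B"
  unfolding hausdorff_measure_def hausdorff_pre_measure_def
  by (rule SUP_mono', rule INF_superset_mono) (use assms in auto)

lemma hausdorff_dim_mono:
  assumes "A \<subseteq> B"
  shows "hausdorff_dim A \<le> hausdorff_dim B"
  unfolding hausdorff_dim_def
proof (rule INF_superset_mono)
  show "{t. 0 \<le> t \<and> hausdorff_measure t B = 0} \<subseteq> {t. 0 \<le> t \<and> hausdorff_measure t A = 0}"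
    using hausdorff_measure_mono[OF assms] by (metis (mono_tags, lifting) Collect_mono_iff le_zero_eq)
qed simp

lemma hausdorff_dim_le:
  assumes "0 \<le> t" "hausdorff_measure t A = 0"
  shows "hausdorff_dim A \<le> ennreal t"
  unfolding hausdorff_dim_def using assms by (intro INF_lower) auto

text \<open>At the critical exponent itself the measure may be positive, so only larger exponents
  are tested; \<open>T\<close> allows these tests to assume an upper bound on t as well.\<close>

lemma hausdorff_dim_le_limit:
  assumes "0 \<le> \<tau>" "\<tau> < T" "\<And>t. \<tau> < t \<Longrightarrow> t < T \<Longrightarrow> hausdorff_measure t A = 0"
  shows "hausdorff_dim A \<le> ennreal \<tau>"
proof (rule ennreal_le_epsilon)
  fix e :: real assume "0 < e"
  define t where "t = \<tau> + min e ((T - \<tau>) / 2)"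
  have t: "\<tau> < t" "t < T" "t \<le> \<tau> + e"
    using \<open>0 < e\<close> assms by (auto simp: t_def min_def field_simps)
  have "hausdorff_dim A \<le> ennreal t"
    using assms t by (intro hausdorff_dim_le) auto
  also have "\<dots> \<le> ennreal (\<tau> + e)"
    using t by (intro ennreal_leI)
  also have "\<dots> = ennreal \<tau> + ennreal e"
    using assms \<open>0 < e\<close> by (simp add: ennreal_plus)
  finally show "hausdorff_dim A \<le> ennreal \<tau> + ennreal e" .
qed

lemma hausdorff_pre_measure_antimono:
  assumes "\<delta> \<le> \<delta>'"
  shows "hausdorff_pre_measure t \<delta>' A \<le> hausdorff_pre_measure t \<delta> A"
  unfolding hausdorff_pre_measure_def
  by (rule INF_superset_mono) (use assms in \<open>auto intro: order_trans\<close>)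

lemma diam_power_antimono:
  assumes "0 \<le> t'" "t' \<le> t" "bounded U" "diameter U \<le> 1"
  shows "diam_power t U \<le> diam_power t' U"
proof -
  have d: "0 \<le> diameter U" using assms by (simp add: diameter_ge_0)
  show ?thesis
  proof (cases "diameter U = 0")
    case True
    then show ?thesis using assms by (auto simp: diam_power_def)
  next
    case False
    then have "diameter U powr t \<le> diameter U powr t'"
      using assms d by (intro powr_mono') auto
    \<comment> \<open>This bound serves the case t' = 0, where \<open>diam_power\<close> takes the
      value 1 on non-empty sets.\<close>
    moreover have "diameter U powr t \<le> 1"
      using assms d by (intro powr_le1) auto
    ultimately show ?thesis
      using assms by (auto simp: diam_power_def ennreal_leI)
  qed
qed

lemma hausdorff_measure_antimono:
  assumes "0 \<le> t'" "t' \<le> t"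
  shows "hausdorff_measure t A \<le> hausdorff_measure t' A"
  unfolding hausdorff_measure_def
proof (rule SUP_least)
  fix \<delta> :: real assume "\<delta> \<in> {0<..}"
  \<comment> \<open>Powers decrease in the exponent only for diameters at most 1, hence the passage
    to finer covers.\<close>
  have "hausdorff_pre_measure t \<delta> A \<le> hausdorff_pre_measure t (min \<delta> 1) A"
    by (intro hausdorff_pre_measure_antimono) auto
  also have "\<dots> \<le> hausdorff_pre_measure t' (min \<delta> 1) A"
    unfolding hausdorff_pre_measure_def
  proof (rule INF_mono)
    fix U :: "nat \<Rightarrow> 'a set"
    assume U: "U \<in> {U. A \<subseteq> (\<Union>i. U i) \<and> (\<forall>i. bounded (U i) \<and> diameter (U i) \<le> min \<delta> 1)}"
    then have "(\<Sum>i. diam_power t (U i)) \<le> (\<Sum>i. diam_power t' (U i))"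
      using assms by (intro suminf_le diam_power_antimono) auto
    with U show "\<exists>U'\<in>{U. A \<subseteq> (\<Union>i. U i) \<and> (\<forall>i. bounded (U i) \<and> diameter (U i) \<le> min \<delta> 1)}.
        (\<Sum>i. diam_power t (U' i)) \<le> (\<Sum>i. diam_power t' (U i))"
      by blast
  qed
  also have "\<dots> \<le> (SUP \<delta>\<in>{0<..}. hausdorff_pre_measure t' \<delta> A)"
    using \<open>\<delta> \<in> {0<..}\<close> by (intro SUP_upper) auto
  finally show "hausdorff_pre_measure t \<delta> A \<le> (SUP \<delta>\<in>{0<..}. hausdorff_pre_measure t' \<delta> A)" .
qed

lemma hausdorff_dim_ge:
  assumes "hausdorff_measure t A \<noteq> 0"
  shows "ennreal t \<le> hausdorff_dim A"
  unfolding hausdorff_dim_def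
proof (rule INF_greatest)
  fix t' assume t': "t' \<in> {t. 0 \<le> t \<and> hausdorff_measure t A = 0}"
  have "t \<le> t'"
  proof (rule ccontr)
    assume "\<not> t \<le> t'"
    then show False
      using hausdorff_measure_antimono[of t' t A] t' assms by auto
  qed
  then show "ennreal t \<le> ennreal t'" by (rule ennreal_leI)
qed

text \<open>A Borel-Cantelli argument: the families from any index on cover \<open>E\<close>, and
  the tail of the convergent series bounds their total mass. Membership for infinitely many j
  suffices, which is all that is available for exceptional directions.\<close>

lemma hausdorff_measure_limsup_eq_0:
  fixes E :: "'a::metric_space set" and \<U> :: "nat \<Rightarrow> 'a set set" and N d :: "nat \<Rightarrow> real"
  assumes t: "0 < t"
    and d: "\<And>j. 0 \<le> d j"
    and fin: "eventually (\<lambda>j. finite (\<U> j) \<and> real (card (\<U> j)) \<le> N j) sequentially"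
    and diam: "\<And>j U x y. U \<in> \<U> j \<Longrightarrow> x \<in> U \<Longrightarrow> y \<in> U \<Longrightarrow> dist x y \<le> d j"
    and summ: "summable (\<lambda>j. N j * d j powr t)"
    and E: "\<And>x. x \<in> E \<Longrightarrow> frequently (\<lambda>j. x \<in> \<Union>(\<U> j)) sequentially"
  shows "hausdorff_measure t E = 0"
proof -
  have "hausdorff_pre_measure t \<delta> E \<le> ennreal \<epsilon>" if "0 < \<delta>" "0 < \<epsilon>" for \<delta> \<epsilon>
  proof -
    obtain J0 where J0: "\<And>j. j \<ge> J0 \<Longrightarrow> finite (\<U> j) \<and> real (card (\<U> j)) \<le> N j"
      using fin by (auto simp: eventually_sequentially)
    define c where "c = (\<lambda>j. N j * d j powr t)"
    \<comment> \<open>A tail below \<epsilon> bounds the mass; a tail below \<delta> powr t also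
      bounds each single term, and so forces d j \<le> \<delta> whenever the family j is non-empty.
      Convergence of d to 0 is thus never assumed.\<close>
    have "min \<epsilon> (\<delta> powr t) > 0" using that by simp
    from suminf_exist_split[OF this summ] obtain J1
      where J1: "\<And>n. n \<ge> J1 \<Longrightarrow> norm (\<Sum>i. c (i + n)) < min \<epsilon> (\<delta> powr t)"
      unfolding c_def by blast
    define J where "J = max J0 J1"
    have fJ: "finite (\<U> j)" "real (card (\<U> j)) \<le> N j" if "j \<ge> J" for j
      using J0[of j] that by (auto simp: J_def)
    have c0: "0 \<le> c j" if "j \<ge> J" for j
      using fJ[OF that] by (auto simp: c_def intro!: mult_nonneg_nonneg)
    have sJ: "summable (\<lambda>i. c (i + J))"
      using summ summable_iff_shift[of c J] by (simp add: c_def)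
    have tail: "(\<Sum>i. c (i + J)) < min \<epsilon> (\<delta> powr t)"
      using J1[of J] by (auto simp: J_def)
    have small: "c j < \<delta> powr t" if "j \<ge> J" for j
    proof -
      have "c (j - J + J) \<le> (\<Sum>i. c (i + J))"
        using sum_le_suminf[OF sJ, of "{j - J}"] c0 by auto
      then show ?thesis using tail that by simp
    qed
    have dsmall: "d j \<le> \<delta>" if "j \<ge> J" "\<U> j \<noteq> {}" for j
    proof -
      have "1 \<le> card (\<U> j)" using fJ(1)[OF that(1)] that(2) by (simp add: Suc_le_eq card_gt_0_iff)
      then have "1 \<le> N j" using fJ(2)[OF that(1)] by linarith
      then have "d j powr t \<le> c j" by (simp add: c_def mult_le_cancel_right1)
      then have "d j powr t < \<delta> powr t" using small[OF that(1)] by simp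
      then show ?thesis
        using powr_mono2[of t \<delta> "d j"] t \<open>0 < \<delta>\<close> by (cases "d j \<le> \<delta>") auto
    qed
    have "\<exists>h. bij_betw h {0..<card (\<U> j)} (\<U> j)" if "j \<ge> J" for j
      using ex_bij_betw_nat_finite[OF fJ(1)[OF that]] by blast
    then obtain h where h: "\<And>j. j \<ge> J \<Longrightarrow> bij_betw (h j) {0..<card (\<U> j)} (\<U> j)"
      by metis
    define V where "V = (\<lambda>(j, k). if j \<ge> J \<and> k < card (\<U> j) then h j k else {})"
    have Vin: "h j k \<in> \<U> j" if "j \<ge> J" "k < card (\<U> j)" for j k
      using bij_betwE[OF h[OF that(1)]] that by auto
    have Vd: "dist x y \<le> d j" if "x \<in> V (j, k)" "y \<in> V (j, k)" for j k x y
    proof -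
      have "j \<ge> J" "k < card (\<U> j)" "x \<in> h j k" "y \<in> h j k"
        using that by (auto simp: V_def split: if_splits)
      then show ?thesis using diam Vin by blast
    qed
    have Vb: "bounded (V p)" for p
    proof (cases p)
      case (Pair j k)
      show ?thesis
      proof (cases "V (j, k) = {}")
        case False
        then obtain x where "x \<in> V (j, k)" by blast
        then have "V (j, k) \<subseteq> cball x (d j)" using Vd by (auto simp: mem_cball)
        then show ?thesis using Pair bounded_cball bounded_subset by blast
      qed (simp add: Pair)
    qed
    have Vdiam: "diameter (V (j, k)) \<le> d j" for j k
      using d[of j] Vd[of _ j k] unfolding diameter_def by (auto intro!: cSUP_least)
    have Vdiam': "diameter (V (j, k)) \<le> \<delta>" for j k
    proof (cases "j \<ge> J \<and> k < card (\<U> j)")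
      case True
      then have "\<U> j \<noteq> {}" by auto
      then show ?thesis using True Vdiam[of j k] dsmall[of j] by linarith
    qed (use \<open>0 < \<delta>\<close> in \<open>auto simp: V_def\<close>)
    have cover: "E \<subseteq> (\<Union>i. V (prod_decode i))"
    proof
      fix x assume "x \<in> E"
      from E[OF this] have "\<exists>j\<ge>J. x \<in> \<Union>(\<U> j)"
        by (auto simp: frequently_def eventually_sequentially)
      then obtain j U where j: "j \<ge> J" "x \<in> U" "U \<in> \<U> j" by blast
      then obtain k where k: "k < card (\<U> j)" "h j k = U"
        using bij_betw_imp_surj_on[OF h[OF j(1)]] by (metis atLeastLessThan_iff imageE)
      have "x \<in> V (prod_decode (prod_encode (j, k)))"
        using j k by (simp add: V_def)
      then show "x \<in> (\<Union>i. V (prod_decode i))" by blast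
    qed
    have row: "(\<Sum>k. diam_power t (V (j, k))) \<le> (if j \<ge> J then ennreal (c j) else 0)" for j
    proof (cases "j \<ge> J")
      case True
      have "(\<Sum>k. diam_power t (V (j, k))) = (\<Sum>k<card (\<U> j). diam_power t (V (j, k)))"
        by (intro suminf_finite) (auto simp: V_def diam_power_def)
      also have "\<dots> \<le> (\<Sum>k<card (\<U> j). ennreal (d j powr t))"
      proof (intro sum_mono)
        fix k
        have "diameter (V (j, k)) powr t \<le> d j powr t"
          using Vdiam diameter_ge_0[OF Vb] t by (intro powr_mono2) auto
        then show "diam_power t (V (j, k)) \<le> ennreal (d j powr t)"
          using t by (auto simp: diam_power_def ennreal_leI)
      qed
      also have "\<dots> = ennreal (real (card (\<U> j)) * d j powr t)"
        by (simp add: ennreal_mult ennreal_of_nat_eq_real_of_nat)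
      also have "\<dots> \<le> ennreal (c j)"
        unfolding c_def by (intro ennreal_leI mult_right_mono fJ(2) True) auto
      finally show ?thesis using True by simp
    qed (simp add: V_def diam_power_def)
    have "hausdorff_pre_measure t \<delta> E \<le> (\<Sum>i. diam_power t (V (prod_decode i)))"
      unfolding hausdorff_pre_measure_def
    proof (rule INF_lower)
      have "bounded (V (prod_decode i)) \<and> diameter (V (prod_decode i)) \<le> \<delta>" for i
        using Vb Vdiam' by (metis surj_pair)
      then show "(\<lambda>i. V (prod_decode i)) \<in> {U. E \<subseteq> (\<Union>i. U i) \<and> (\<forall>i. bounded (U i) \<and> diameter (U i) \<le> \<delta>)}"
        using cover by auto
    qed
    also have "\<dots> = (\<Sum>j. \<Sum>k. diam_power t (V (j, k)))"
      using suminf_ennreal_2dimen[where f = "\<lambda>p. diam_power t (V p)", OF refl] by simp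
    also have "\<dots> \<le> (\<Sum>j. if j \<ge> J then ennreal (c j) else 0)"
      by (intro suminf_le row) auto
    also have "\<dots> = (\<Sum>j. ennreal (c (j + J)))"
      by (subst suminf_offset[where i = J]) auto
    also have "\<dots> = ennreal (\<Sum>j. c (j + J))"
      using sJ c0 by (intro suminf_ennreal2) auto
    also have "\<dots> \<le> ennreal \<epsilon>"
      using tail by (intro ennreal_leI) auto
    finally show ?thesis .
  qed
  then have "hausdorff_pre_measure t \<delta> E = 0" if "0 < \<delta>" for \<delta>
    using that by (metis add_0 ennreal_le_epsilon le_zero_eq)
  then show ?thesis
    by (simp add: hausdorff_measure_def)
qed

text \<open>
  Counting measures of finite sets take the place of a measure on \<open>K\<close>: a finite subcover only
  involves sets whose diameters are bounded below, so a single \<open>P n\<close> suffices.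
\<close>

lemma mass_distribution_principle:
  fixes K :: "'a::metric_space set" and P :: "nat \<Rightarrow> 'i set" and h :: "'i \<Rightarrow> 'a" and \<rho> :: "nat \<Rightarrow> real"
  assumes K: "compact K" and t: "0 < t" and C: "0 < C"
    and fin: "\<And>n. finite (P n)" "\<And>n. P n \<noteq> {}"
    and sub: "\<And>n i. i \<in> P n \<Longrightarrow> h i \<in> K"
    and \<rho>: "\<rho> \<longlonglongrightarrow> 0"
    and count: "eventually (\<lambda>n. \<forall>U r. \<rho> n \<le> r \<longrightarrow> 0 < r \<longrightarrow> (\<forall>x\<in>U. \<forall>y\<in>U. dist x y \<le> r) \<longrightarrow>
      real (card {i \<in> P n. h i \<in> U}) \<le> C * real (card (P n)) * r powr t) sequentially"
  shows "ennreal t \<le> hausdorff_dim K"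
proof (rule hausdorff_dim_ge, rule notI)
  assume H0: "hausdorff_measure t K = 0"
  \<comment> \<open>The cover will be charged at most 2 \<epsilon>, so this value accounts for at
    most half of the points of \<open>P n\<close>, a contradiction.\<close>
  define \<epsilon> where "\<epsilon> = 1 / (4 * C)"
  have \<epsilon>: "\<epsilon> > 0" using C by (simp add: \<epsilon>_def)
  have "hausdorff_pre_measure t 1 K \<le> hausdorff_measure t K"
    unfolding hausdorff_measure_def by (intro SUP_upper) auto
  then have "hausdorff_pre_measure t 1 K < ennreal \<epsilon>"
    using H0 \<epsilon> by (simp add: le_zero_eq)
  then obtain U where U: "K \<subseteq> (\<Union>i. U i)" "\<And>i. bounded (U i)"
      "(\<Sum>i. diam_power t (U i)) < ennreal \<epsilon>"
    unfolding hausdorff_pre_measure_def by (auto simp: INF_less_iff)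
  \<comment> \<open>Each covering set is fattened to an open set so that compactness applies. The
    allowances \<epsilon> / 2 ^ (i + 1) sum to \<epsilon>; they are attainable by continuity of the
    power, including at diameter 0 because t > 0.\<close>
  have "\<exists>\<eta>>0. (diameter (U i) + 2 * \<eta>) powr t \<le> diameter (U i) powr t + \<epsilon> * (1/2) ^ Suc i" for i
  proof -
    have d0: "0 \<le> diameter (U i)" using U(2) by (simp add: diameter_ge_0)
    have "((\<lambda>\<eta>. (diameter (U i) + 2 * \<eta>) powr t) \<longlongrightarrow> (diameter (U i) + 2 * 0) powr t) (at_right 0)"
      using d0 t by (intro tendsto_powr' tendsto_intros)
        (auto simp: eventually_at_right_less intro!: eventually_at_rightI[of 0 1])
    moreover have "(diameter (U i) + 2 * 0) powr t < diameter (U i) powr t + \<epsilon> * (1/2) ^ Suc i"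
      using \<epsilon> by simp
    ultimately have "\<forall>\<^sub>F \<eta> in at_right 0. (diameter (U i) + 2 * \<eta>) powr t < diameter (U i) powr t + \<epsilon> * (1/2) ^ Suc i"
      by (rule order_tendstoD(2))
    then have "\<forall>\<^sub>F \<eta> in at_right 0. 0 < \<eta> \<and> (diameter (U i) + 2 * \<eta>) powr t \<le> diameter (U i) powr t + \<epsilon> * (1/2) ^ Suc i"
      using eventually_at_right_less[of 0] by eventually_elim auto
    from eventually_happens'[OF _ this] show ?thesis by auto
  qed
  then obtain \<eta> where \<eta>: "\<And>i. \<eta> i > 0"
      "\<And>i. (diameter (U i) + 2 * \<eta> i) powr t \<le> diameter (U i) powr t + \<epsilon> * (1/2) ^ Suc i"
    by metis
  define V where "V = (\<lambda>i. \<Union>x\<in>U i. ball x (\<eta> i))"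
  define r where "r = (\<lambda>i. diameter (U i) + 2 * \<eta> i)"
  have r0: "r i > 0" for i
    using \<eta>(1)[of i] diameter_ge_0[OF U(2), of i] by (simp add: r_def)
  have Vr: "dist x y \<le> r i" if xy: "x \<in> V i" "y \<in> V i" for i x y
  proof -
    obtain x' y' where x': "x' \<in> U i" "dist x' x < \<eta> i" and y': "y' \<in> U i" "dist y' y < \<eta> i"
      using xy by (auto simp: V_def)
    have "dist x' y' \<le> diameter (U i)"
      using diameter_bounded_bound[OF U(2) x'(1) y'(1)] .
    then show ?thesis
      using x'(2) y'(2) dist_triangle[of x y x'] dist_triangle[of x' y y']
      by (simp add: r_def dist_commute)
  qed
  have "K \<subseteq> (\<Union>i\<in>UNIV. V i)"
  proof
    fix x assume "x \<in> K"
    then obtain i where "x \<in> U i" using U(1) by blast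
    moreover have "x \<in> ball x (\<eta> i)" using \<eta>(1) by simp
    ultimately show "x \<in> (\<Union>i\<in>UNIV. V i)" unfolding V_def by blast
  qed
  moreover have "open (V i)" for i
    by (auto simp: V_def)
  ultimately obtain I where I: "finite I" "K \<subseteq> (\<Union>i\<in>I. V i)"
    using compactE_image[OF K, of UNIV V] by auto
  have "\<forall>\<^sub>F n in sequentially. \<forall>i\<in>I. \<rho> n \<le> r i"
    using I(1)
  proof (subst eventually_ball_finite_distrib)
    show "\<forall>i\<in>I. \<forall>\<^sub>F n in sequentially. \<rho> n \<le> r i"
    proof
      fix i
      show "\<forall>\<^sub>F n in sequentially. \<rho> n \<le> r i"
        using order_tendstoD(2)[OF \<rho> r0[of i]] by eventually_elim simp
    qed
  qed auto
  from eventually_happens'[OF _ eventually_conj[OF this count]]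
  obtain n where n: "\<And>i. i \<in> I \<Longrightarrow> \<rho> n \<le> r i"
    and cnt: "\<And>U r. \<rho> n \<le> r \<Longrightarrow> 0 < r \<Longrightarrow> (\<forall>x\<in>U. \<forall>y\<in>U. dist x y \<le> r) \<Longrightarrow>
      real (card {i \<in> P n. h i \<in> U}) \<le> C * real (card (P n)) * r powr t"
    by auto
  have "(\<Sum>i\<in>I. ennreal (r i powr t)) \<le> (\<Sum>i\<in>I. diam_power t (U i) + ennreal (\<epsilon> * (1/2) ^ Suc i))"
  proof (rule sum_mono)
    fix i
    have "ennreal (r i powr t) \<le> ennreal (diameter (U i) powr t + \<epsilon> * (1/2) ^ Suc i)"
      using \<eta>(2)[of i] by (intro ennreal_leI) (simp add: r_def)
    also have "\<dots> = diam_power t (U i) + ennreal (\<epsilon> * (1/2) ^ Suc i)"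
      using t \<epsilon> by (subst ennreal_plus) (auto simp: diam_power_def)
    finally show "ennreal (r i powr t) \<le> diam_power t (U i) + ennreal (\<epsilon> * (1/2) ^ Suc i)" .
  qed
  also have "\<dots> \<le> (\<Sum>i. diam_power t (U i) + ennreal (\<epsilon> * (1/2) ^ Suc i))"
    by (intro sum_le_suminf I(1)) auto
  also have "\<dots> = (\<Sum>i. diam_power t (U i)) + (\<Sum>i. ennreal (\<epsilon> * (1/2) ^ Suc i))"
    by (intro suminf_add[symmetric]) auto
  also have "(\<Sum>i. ennreal (\<epsilon> * (1/2) ^ Suc i)) = ennreal \<epsilon>"
    using sums_mult[OF power_half_series, of \<epsilon>] \<epsilon> by (intro suminf_ennreal_eq) auto
  also have "(\<Sum>i. diam_power t (U i)) + ennreal \<epsilon> \<le> ennreal \<epsilon> + ennreal \<epsilon>"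
    using U(3) by (intro add_right_mono) auto
  also have "\<dots> = ennreal (2 * \<epsilon>)"
    using \<epsilon> by (simp flip: ennreal_plus)
  finally have le: "(\<Sum>i\<in>I. r i powr t) \<le> 2 * \<epsilon>"
    using \<epsilon> by (simp add: sum_ennreal)
  have "P n \<subseteq> (\<Union>i\<in>I. {p \<in> P n. h p \<in> V i})"
    using I(2) sub[of _ n] by blast
  then have "card (P n) \<le> card (\<Union>i\<in>I. {p \<in> P n. h p \<in> V i})"
    using I(1) fin by (intro card_mono) auto
  also have "\<dots> \<le> (\<Sum>i\<in>I. card {p \<in> P n. h p \<in> V i})"
    using I(1) by (rule card_UN_le)
  finally have "real (card (P n)) \<le> (\<Sum>i\<in>I. real (card {p \<in> P n. h p \<in> V i}))"
    by (metis of_nat_le_iff of_nat_sum)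
  also have "\<dots> \<le> (\<Sum>i\<in>I. C * real (card (P n)) * r i powr t)"
    using cnt n r0 Vr by (intro sum_mono) auto
  also have "\<dots> = C * real (card (P n)) * (\<Sum>i\<in>I. r i powr t)"
    by (simp add: sum_distrib_left)
  also have "\<dots> \<le> C * real (card (P n)) * (2 * \<epsilon>)"
    using C le by (intro mult_left_mono) auto
  also have "\<dots> = real (card (P n)) / 2"
    using C by (simp add: \<epsilon>_def)
  finally show False
    using fin[of n] by (simp add: card_gt_0_iff)
qed

section \<open>Lines in the plane and their projections\<close>

definition slope_line :: "real \<Rightarrow> G21" where
  "slope_line \<theta> = Abs_G21 (span {vector [1, \<theta>]})"

definition vertical_line :: G21 where
  "vertical_line = Abs_G21 (span {vector [0, 1]})"

lemma vector_1_neq_0: "(vector [1, \<theta>] :: real^2) \<noteq> 0" "(vector [0, 1] :: real^2) \<noteq> 0"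
  by (auto simp: vec_eq_iff forall_2)

lemma line_of_slope_line: "line_of (slope_line \<theta>) = span {vector [1, \<theta>]}"
  unfolding slope_line_def
  by (rule Abs_G21_inverse) (simp add: subspace_span dim_span dim_singleton vector_1_neq_0)

lemma line_of_vertical_line: "line_of vertical_line = span {vector [0, 1]}"
  unfolding vertical_line_def
  by (rule Abs_G21_inverse) (simp add: subspace_span dim_span dim_singleton vector_1_neq_0)

lemma proj_slope_line:
  "proj_line (slope_line \<theta>) x = ((x $ 1 + \<theta> * x $ 2) / (1 + \<theta>\<^sup>2)) *\<^sub>R vector [1, \<theta>]"
  unfolding proj_line_def
proof (rule orth_proj_eqI)
  fix v assume "v \<in> line_of (slope_line \<theta>)"
  then obtain k where v: "v = k *\<^sub>R vector [1, \<theta>]"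
    by (auto simp: line_of_slope_line span_singleton)
  have "1 + \<theta>\<^sup>2 \<noteq> 0" by (smt (verit) zero_le_power2)
  then show "orthogonal (x - ((x $ 1 + \<theta> * x $ 2) / (1 + \<theta>\<^sup>2)) *\<^sub>R vector [1, \<theta>]) v"
    by (simp add: v orthogonal_def inner_vec_def sum_2 field_simps power2_eq_square)
qed (auto simp: line_of_slope_line span_base span_scale)

lemma G21_cases: "V = vertical_line \<or> (\<exists>\<theta>. V = slope_line \<theta>)"
proof -
  have V: "subspace (line_of V)" "dim (line_of V) = 1"
    using line_of[of V] by auto
  then have "\<exists>v\<in>line_of V. v \<noteq> 0"
    by (metis dim_eq_0 singletonI subsetI zero_neq_one)
  then obtain v where v: "v \<in> line_of V" "v \<noteq> 0" by blast
  have span: "line_of V = span {w}" if w: "w \<in> line_of V" "w \<noteq> 0" for w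
  proof (rule sym, rule subspace_dim_equal)
    show "span {w} \<subseteq> line_of V"
      using w V by (simp add: span_minimal)
    show "dim (line_of V) \<le> dim (span {w})"
      using V(2) w by (simp add: dim_span dim_singleton)
  qed (use V in \<open>auto simp: subspace_span\<close>)
  show ?thesis
  proof (cases "v $ 1 = 0")
    case True
    then have "v $ 2 \<noteq> 0" using v(2) by (auto simp: vec_eq_iff forall_2)
    moreover have "vector [0, 1] = (1 / v $ 2) *\<^sub>R v"
      using True calculation by (simp add: vec_eq_iff forall_2)
    ultimately have "vector [0, 1] \<in> line_of V"
      using v(1) V(1) by (simp add: subspace_scale)
    from span[OF this] have "line_of V = line_of vertical_line"
      by (simp add: line_of_vertical_line vector_1_neq_0)
    then show ?thesis by (simp add: line_of_inject)
  next
    case False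
    then have "vector [1, v $ 2 / v $ 1] = (1 / v $ 1) *\<^sub>R v"
      by (simp add: vec_eq_iff forall_2)
    then have "vector [1, v $ 2 / v $ 1] \<in> line_of V"
      using v(1) V(1) by (simp add: subspace_scale)
    from span[OF this] have "line_of V = line_of (slope_line (v $ 2 / v $ 1))"
      by (simp add: line_of_slope_line vector_1_neq_0)
    then show ?thesis by (auto simp: line_of_inject)
  qed
qed

lemma norm_vector_2: "norm (vector [a, b] :: real^2) = sqrt (a\<^sup>2 + b\<^sup>2)"
  by (simp add: norm_vec_def L2_set_def sum_2)

text \<open>Up to a constant depending on \<theta>, projecting amounts to evaluating x + \<theta> y.
  This reduces covering and counting on the line to intervals of real numbers.\<close>

lemma dist_proj_slope_line:
  "dist (proj_line (slope_line \<theta>) x) (proj_line (slope_line \<theta>) y) =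
     \<bar>(x $ 1 + \<theta> * x $ 2) - (y $ 1 + \<theta> * y $ 2)\<bar> / sqrt (1 + \<theta>\<^sup>2)"
proof -
  have pos: "1 + \<theta>\<^sup>2 > 0" by (smt (verit) zero_le_power2)
  have "dist (proj_line (slope_line \<theta>) x) (proj_line (slope_line \<theta>) y) =
      norm ((((x $ 1 + \<theta> * x $ 2) - (y $ 1 + \<theta> * y $ 2)) / (1 + \<theta>\<^sup>2)) *\<^sub>R (vector [1, \<theta>] :: real^2))"
    by (simp add: dist_norm proj_slope_line diff_divide_distrib flip: scaleR_left_diff_distrib)
  also have "\<dots> = \<bar>(x $ 1 + \<theta> * x $ 2) - (y $ 1 + \<theta> * y $ 2)\<bar> / (1 + \<theta>\<^sup>2) * sqrt (1 + \<theta>\<^sup>2)"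
    using pos by (simp add: norm_vector_2)
  also have "\<dots> = \<bar>(x $ 1 + \<theta> * x $ 2) - (y $ 1 + \<theta> * y $ 2)\<bar> / sqrt (1 + \<theta>\<^sup>2)"
    using pos real_sqrt_pow2[of "1 + \<theta>\<^sup>2"] by (simp add: divide_simps power2_eq_square)
  finally show ?thesis .
qed

lemma dist_proj_slope_line_le:
  "dist (proj_line (slope_line \<theta>) x) (proj_line (slope_line \<theta>) y) \<le>
     \<bar>(x $ 1 + \<theta> * x $ 2) - (y $ 1 + \<theta> * y $ 2)\<bar>"
proof -
  have "1 \<le> sqrt (1 + \<theta>\<^sup>2)" by simp
  then have "a / sqrt (1 + \<theta>\<^sup>2) \<le> a / 1" if "0 \<le> a" for a
    using that by (intro divide_left_mono) (auto simp: add_pos_nonneg)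
  then show ?thesis
    unfolding dist_proj_slope_line by simp
qed

lemma dist_proj_slope_line_ge:
  "\<bar>(x $ 1 + \<theta> * x $ 2) - (y $ 1 + \<theta> * y $ 2)\<bar> \<le>
     (1 + \<bar>\<theta>\<bar>) * dist (proj_line (slope_line \<theta>) x) (proj_line (slope_line \<theta>) y)"
proof -
  have "sqrt (1 + \<theta>\<^sup>2) \<le> 1 + \<bar>\<theta>\<bar>"
    by (rule real_le_lsqrt) (auto simp: power2_eq_square algebra_simps)
  moreover have "sqrt (1 + \<theta>\<^sup>2) > 0" by (simp add: add_pos_nonneg)
  ultimately show ?thesis
    unfolding dist_proj_slope_line by (simp add: pos_le_divide_eq mult.commute[of "1 + _"] mult_left_mono)
qed

text \<open>These functions are the entries of the matrix of the projection: 1 / (1 + \<theta>^2),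
  twice \<theta> / (1 + \<theta>^2), and 1 - 1 / (1 + \<theta>^2).\<close>

lemma Lipschitz_1_over_1_plus_square:
  fixes a b :: real
  shows "\<bar>1 / (1 + a\<^sup>2) - 1 / (1 + b\<^sup>2)\<bar> \<le> \<bar>a - b\<bar>"
    and "\<bar>a / (1 + a\<^sup>2) - b / (1 + b\<^sup>2)\<bar> \<le> \<bar>a - b\<bar>"
proof -
  have pos: "0 < 1 + a\<^sup>2" "0 < 1 + b\<^sup>2" by (smt (verit) zero_le_power2)+
  have e: "1 / (1 + a\<^sup>2) - 1 / (1 + b\<^sup>2) = (a - b) * (- (a + b) / ((1 + a\<^sup>2) * (1 + b\<^sup>2)))"
    "a / (1 + a\<^sup>2) - b / (1 + b\<^sup>2) = (a - b) * ((1 - a * b) / ((1 + a\<^sup>2) * (1 + b\<^sup>2)))"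
    using pos by (simp_all add: divide_simps) (simp_all add: algebra_simps power2_eq_square)
  have p: "(1 + a\<^sup>2) * (1 + b\<^sup>2) = 1 + a\<^sup>2 + b\<^sup>2 + (a * b)\<^sup>2"
    by (simp add: algebra_simps power2_eq_square)
  have sq: "0 \<le> (\<bar>a\<bar> - 1)\<^sup>2" "0 \<le> (\<bar>b\<bar> - 1)\<^sup>2" "0 \<le> (\<bar>a * b\<bar> - 1)\<^sup>2" by auto
  have "\<bar>a\<bar> \<le> 1/2 + a\<^sup>2/2" "\<bar>b\<bar> \<le> 1/2 + b\<^sup>2/2" "\<bar>a * b\<bar> \<le> a\<^sup>2/2 + b\<^sup>2/2"
    using sq sum_squares_bound[of "\<bar>a\<bar>" "\<bar>b\<bar>"] by (simp_all add: power2_diff abs_mult)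
  then have "\<bar>- (a + b)\<bar> \<le> (1 + a\<^sup>2) * (1 + b\<^sup>2)" "\<bar>1 - a * b\<bar> \<le> (1 + a\<^sup>2) * (1 + b\<^sup>2)"
    unfolding p
    using abs_triangle_ineq[of a b] abs_triangle_ineq4[of 1 "a * b"] zero_le_power2[of "a * b"]
      zero_le_power2[of a] zero_le_power2[of b] by linarith+
  then have "\<bar>- (a + b) / ((1 + a\<^sup>2) * (1 + b\<^sup>2))\<bar> \<le> 1" "\<bar>(1 - a * b) / ((1 + a\<^sup>2) * (1 + b\<^sup>2))\<bar> \<le> 1"
    using pos by (simp_all add: abs_divide abs_mult)
  then show "\<bar>1 / (1 + a\<^sup>2) - 1 / (1 + b\<^sup>2)\<bar> \<le> \<bar>a - b\<bar>"
    "\<bar>a / (1 + a\<^sup>2) - b / (1 + b\<^sup>2)\<bar> \<le> \<bar>a - b\<bar>"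
    unfolding e abs_mult by (metis mult.right_neutral mult_left_mono abs_ge_zero)+
qed

lemma dist_slope_line_le: "dist (slope_line \<theta>) (slope_line \<theta>') \<le> 4 * \<bar>\<theta> - \<theta>'\<bar>"
  unfolding dist_G21_def
proof (rule onorm_le)
  fix x :: "real^2"
  define d where "d = proj_line (slope_line \<theta>) x - proj_line (slope_line \<theta>') x"
  define A where "A = 1 / (1 + \<theta>\<^sup>2) - 1 / (1 + \<theta>'\<^sup>2)"
  define B where "B = \<theta> / (1 + \<theta>\<^sup>2) - \<theta>' / (1 + \<theta>'\<^sup>2)"
  have AB: "\<bar>A\<bar> \<le> \<bar>\<theta> - \<theta>'\<bar>" "\<bar>B\<bar> \<le> \<bar>\<theta> - \<theta>'\<bar>"
    unfolding A_def B_def by (rule Lipschitz_1_over_1_plus_square)+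
  have sq: "\<theta>\<^sup>2 / (1 + \<theta>\<^sup>2) = 1 - 1 / (1 + \<theta>\<^sup>2)" for \<theta> :: real
  proof -
    have "1 + \<theta>\<^sup>2 \<noteq> 0" by (smt (verit) zero_le_power2)
    then show ?thesis by (simp add: field_simps)
  qed
  have p1: "proj_line (slope_line \<theta>) x $ 1 = 1 / (1 + \<theta>\<^sup>2) * x $ 1 + \<theta> / (1 + \<theta>\<^sup>2) * x $ 2" for \<theta>
    unfolding proj_slope_line by (simp add: add_divide_distrib)
  have p2: "proj_line (slope_line \<theta>) x $ 2 = \<theta> / (1 + \<theta>\<^sup>2) * x $ 1 + (1 - 1 / (1 + \<theta>\<^sup>2)) * x $ 2" for \<theta>
    unfolding proj_slope_line sq[symmetric] by (simp add: add_divide_distrib algebra_simps power2_eq_square)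
  have c: "d $ 1 = A * x $ 1 + B * x $ 2" "d $ 2 = B * x $ 1 - A * x $ 2"
    unfolding d_def A_def B_def by (simp_all add: p1 p2 algebra_simps)
  have x: "\<bar>x $ 1\<bar> \<le> norm x" "\<bar>x $ 2\<bar> \<le> norm x"
    by (rule component_le_norm_cart)+
  have "norm d \<le> (\<Sum>i\<in>UNIV. \<bar>d $ i\<bar>)" by (rule norm_le_l1_cart)
  also have "\<dots> = \<bar>A * x $ 1 + B * x $ 2\<bar> + \<bar>B * x $ 1 - A * x $ 2\<bar>"
    by (simp add: sum_2 c)
  also have "\<dots> \<le> \<bar>A\<bar> * \<bar>x $ 1\<bar> + \<bar>B\<bar> * \<bar>x $ 2\<bar> + (\<bar>B\<bar> * \<bar>x $ 1\<bar> + \<bar>A\<bar> * \<bar>x $ 2\<bar>)"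
    by (intro add_mono order_trans[OF abs_triangle_ineq] order_trans[OF abs_triangle_ineq4]) (auto simp: abs_mult)
  also have "\<dots> \<le> \<bar>\<theta> - \<theta>'\<bar> * norm x + \<bar>\<theta> - \<theta>'\<bar> * norm x + (\<bar>\<theta> - \<theta>'\<bar> * norm x + \<bar>\<theta> - \<theta>'\<bar> * norm x)"
    using AB x by (intro add_mono mult_mono) auto
  finally show "norm (proj_line (slope_line \<theta>) x - proj_line (slope_line \<theta>') x) \<le> 4 * \<bar>\<theta> - \<theta>'\<bar> * norm x"
    by (simp add: d_def ac_simps)
qed

lemma dist_slope_line_ge:
  assumes "\<theta> \<in> {0..1}" "\<theta>' \<in> {0..1}"
  shows "\<bar>\<theta> - \<theta>'\<bar> \<le> 2 * dist (slope_line \<theta>) (slope_line \<theta>')"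
proof -
  \<comment> \<open>This vector is orthogonal to the line of slope \<theta>', so its second
    projection vanishes and the difference of the projections reduces to the first one.\<close>
  define v :: "real^2" where "v = vector [- \<theta>', 1]"
  have bl: "bounded_linear (\<lambda>x. proj_line (slope_line \<theta>) x - proj_line (slope_line \<theta>') x)"
    by (intro bounded_linear_sub bounded_linear_proj_line)
  have s: "1 \<le> sqrt (1 + x\<^sup>2)" "sqrt (1 + x\<^sup>2) \<le> sqrt 2" if "x \<in> {0..1}" for x :: real
    using that power_mono[of x 1 2] by auto
  have "\<bar>\<theta> - \<theta>'\<bar> / sqrt (1 + \<theta>\<^sup>2) = dist (proj_line (slope_line \<theta>) v) (proj_line (slope_line \<theta>) 0)"
    unfolding dist_proj_slope_line by (simp add: v_def)
  also have "\<dots> = norm (proj_line (slope_line \<theta>) v - proj_line (slope_line \<theta>') v)"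
    by (simp add: dist_norm proj_slope_line v_def)
  also have "\<dots> \<le> dist (slope_line \<theta>) (slope_line \<theta>') * norm v"
    unfolding dist_G21_def by (rule onorm[OF bl])
  also have "\<dots> \<le> dist (slope_line \<theta>) (slope_line \<theta>') * sqrt 2"
    using s(2)[OF assms(2)] by (intro mult_left_mono) (auto simp: v_def norm_vector_2 add.commute)
  finally have "\<bar>\<theta> - \<theta>'\<bar> \<le> dist (slope_line \<theta>) (slope_line \<theta>') * sqrt 2 * sqrt (1 + \<theta>\<^sup>2)"
    using s(1)[OF assms(1)] by (subst (asm) pos_divide_le_eq) (auto simp: add_pos_nonneg)
  also have "\<dots> \<le> dist (slope_line \<theta>) (slope_line \<theta>') * sqrt 2 * sqrt 2"
    using s(2)[OF assms(1)] by (intro mult_left_mono) auto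
  finally show ?thesis by (simp add: mult.assoc)
qed

lemma continuous_on_slope_line: "continuous_on S slope_line"
proof (rule continuous_onI)
  fix x e :: real assume "0 < e"
  moreover have "dist (slope_line x') (slope_line x) \<le> e" if "dist x' x < e / 4" for x'
    using that dist_slope_line_le[of x' x] by (simp add: dist_real_def)
  ultimately show "\<exists>d>0. \<forall>x'\<in>S. dist x' x < d \<longrightarrow> dist (slope_line x') (slope_line x) \<le> e"
    by (intro exI[of _ "e / 4"]) auto
qed

section \<open>Cantor sets with prescribed digit gaps\<close>

text \<open>Essentially the numbers whose binary digits in positions a j + 1 to m j vanish for all
  j. The intervals include both endpoints, which makes the set compact at the price of some numbers
  with ambiguous cells.\<close>

definition gap_cantor :: "(nat \<Rightarrow> nat) \<Rightarrow> (nat \<Rightarrow> nat) \<Rightarrow> real set" where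
  "gap_cantor m a = {x \<in> {0..1}. \<forall>j. \<exists>k::nat. real k / 2 ^ a j \<le> x \<and> x \<le> real k / 2 ^ a j + 1 / 2 ^ m j}"

text \<open>Finite binary expansions with free digits exactly in positions m i + 1 to a (i + 1) for
  i < j. Level 0 is the single point 0, so all digits up to position m 0 are zero.\<close>

fun gap_points :: "(nat \<Rightarrow> nat) \<Rightarrow> (nat \<Rightarrow> nat) \<Rightarrow> nat \<Rightarrow> real set" where
  "gap_points m a 0 = {0}"
| "gap_points m a (Suc j) =
     (\<lambda>(x, c). x + real c / 2 ^ a (Suc j)) ` (gap_points m a j \<times> {..<2 ^ (a (Suc j) - m j)})"

lemma closed_gap_condition:
  "closed {x \<in> {0..1}. \<exists>k::nat. real k / 2 ^ a \<le> x \<and> x \<le> real k / 2 ^ a + 1 / 2 ^ m}"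
proof -
  \<comment> \<open>Since x \<le> 1, only k \<le> 2 ^ a can occur, and the union of closed intervals
    becomes finite.\<close>
  have "{x \<in> {0..1}. \<exists>k::nat. real k / 2 ^ a \<le> x \<and> x \<le> real k / 2 ^ a + 1 / 2 ^ m} =
      {0..1} \<inter> (\<Union>k\<in>{..2 ^ a}. {real k / 2 ^ a..real k / 2 ^ a + 1 / 2 ^ m})"
  proof (intro set_eqI iffI)
    fix x :: real
    assume "x \<in> {x \<in> {0..1}. \<exists>k::nat. real k / 2 ^ a \<le> x \<and> x \<le> real k / 2 ^ a + 1 / 2 ^ m}"
    then obtain k :: nat where k: "x \<in> {0..1}" "real k / 2 ^ a \<le> x" "x \<le> real k / 2 ^ a + 1 / 2 ^ m"
      by blast
    then have "real k / 2 ^ a \<le> 1" by (meson atLeastAtMost_iff order_trans)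
    then have "real k \<le> real (2 ^ a)" by (simp add: divide_le_eq)
    then have "k \<le> 2 ^ a" by (metis of_nat_le_iff of_nat_numeral of_nat_power)
    with k show "x \<in> {0..1} \<inter> (\<Union>k\<in>{..2 ^ a}. {real k / 2 ^ a..real k / 2 ^ a + 1 / 2 ^ m})"
      by auto
  qed auto
  then show ?thesis by (auto intro!: closed_Int closed_UN)
qed

lemma compact_gap_cantor: "compact (gap_cantor m a)"
proof -
  have "gap_cantor m a =
      (\<Inter>j. {x \<in> {0..1}. \<exists>k::nat. real k / 2 ^ a j \<le> x \<and> x \<le> real k / 2 ^ a j + 1 / 2 ^ m j})"
    by (auto simp: gap_cantor_def)
  then have "closed (gap_cantor m a)"
    using closed_gap_condition by (auto intro!: closed_INT)
  moreover have "bounded (gap_cantor m a)"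
    by (rule bounded_subset[of "{0..1}"]) (auto simp: gap_cantor_def)
  ultimately show ?thesis by (simp add: compact_eq_bounded_closed)
qed

lemma inverse_power_2_mono: "i \<le> j \<Longrightarrow> 1 / 2 ^ j \<le> (1 / 2 ^ i :: real)"
  by (simp add: frac_le)

lemma card_nat_interval_le:
  fixes p L :: real
  assumes "0 \<le> L"
  shows "finite {c::nat. p \<le> real c \<and> real c \<le> p + L}"
    and "real (card {c::nat. p \<le> real c \<and> real c \<le> p + L}) \<le> L + 1"
proof -
  let ?S = "{c::nat. p \<le> real c \<and> real c \<le> p + L}"
  have "?S \<subseteq> {..nat \<lceil>p + L\<rceil>}"
  proof
    fix c assume "c \<in> ?S"
    then have "real c \<le> p + L" by simp
    then show "c \<in> {..nat \<lceil>p + L\<rceil>}" by (simp add: le_nat_iff) linarith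
  qed
  then show fin: "finite ?S" by (rule finite_subset) simp
  show "real (card ?S) \<le> L + 1"
  proof (cases "?S = {}")
    case False
    define c0 where "c0 = Min ?S"
    have c0: "c0 \<in> ?S" unfolding c0_def by (rule Min_in[OF fin False])
    have "?S \<subseteq> {c0..c0 + nat \<lfloor>L\<rfloor>}"
    proof
      fix c assume c: "c \<in> ?S"
      have "c0 \<le> c" unfolding c0_def by (rule Min_le[OF fin c])
      moreover have "real c - real c0 \<le> L" using c c0 by simp
      ultimately have "real (c - c0) \<le> L" by (simp add: of_nat_diff)
      then have "c - c0 \<le> nat \<lfloor>L\<rfloor>" by (simp add: le_nat_iff le_floor_iff)
      with \<open>c0 \<le> c\<close> show "c \<in> {c0..c0 + nat \<lfloor>L\<rfloor>}" by simp
    qed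
    then have "card ?S \<le> nat \<lfloor>L\<rfloor> + 1" using card_mono[of "{c0..c0 + nat \<lfloor>L\<rfloor>}" ?S] by simp
    then have "real (card ?S) \<le> real (nat \<lfloor>L\<rfloor>) + 1" by linarith
    also have "\<dots> \<le> L + 1" using assms by linarith
    finally show ?thesis .
  next
    case True
    then show ?thesis unfolding True using assms by simp
  qed
qed

locale gap_scales =
  fixes m a :: "nat \<Rightarrow> nat"
  assumes a_le_m: "a j \<le> m j" and m_le_a: "m j \<le> a (Suc j)"
begin

lemma a_mono: "i \<le> j \<Longrightarrow> a i \<le> a j"
  by (rule lift_Suc_mono_le[of a]) (use a_le_m m_le_a order_trans in blast)

lemma m_mono: "i \<le> j \<Longrightarrow> m i \<le> m j"
  by (rule lift_Suc_mono_le[of m]) (use a_le_m m_le_a order_trans in blast)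

text \<open>The subtracted last unit 1 / 2 ^ a (j + 1) is at least 1 / 2 ^ m (j + 1); it is the room
  into which all later digits fit, and it makes the estimates over several levels telescope.\<close>

lemma digit_le:
  assumes "c < 2 ^ (a (Suc j) - m j)"
  shows "real c / 2 ^ a (Suc j) \<le> 1 / 2 ^ m j - 1 / 2 ^ a (Suc j)"
proof -
  have "real c + 1 \<le> 2 ^ (a (Suc j) - m j)"
    using assms by (metis Suc_eq_plus1 Suc_leI numeral_power_eq_of_nat_cancel_iff of_nat_1 of_nat_add of_nat_le_iff of_nat_numeral of_nat_power)
  then have "(real c + 1) / 2 ^ a (Suc j) \<le> 2 ^ (a (Suc j) - m j) / 2 ^ a (Suc j)"
    by (intro divide_right_mono) auto
  also have "\<dots> = 1 / 2 ^ m j"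
    using m_le_a[of j] by (simp add: power_diff)
  finally show ?thesis by (simp add: add_divide_distrib)
qed

lemma finite_gap_points [simp]: "finite (gap_points m a j)"
  by (induction j) auto

lemma zero_in_gap_points [simp]: "0 \<in> gap_points m a j"
  by (induction j) (force simp: image_iff)+

lemma gap_points_nonempty [simp]: "gap_points m a j \<noteq> {}"
  using zero_in_gap_points by blast

lemma gap_points_mono: "i \<le> j \<Longrightarrow> gap_points m a i \<subseteq> gap_points m a j"
proof (rule lift_Suc_mono_le[of "gap_points m a"])
  fix j
  show "gap_points m a j \<subseteq> gap_points m a (Suc j)"
  proof
    fix x assume "x \<in> gap_points m a j"
    then show "x \<in> gap_points m a (Suc j)"
      by (auto intro!: image_eqI[of _ _ "(x, 0)"])
  qed
qed

lemma gap_points_grid: "x \<in> gap_points m a j \<Longrightarrow> \<exists>k. x = real k / 2 ^ a j \<and> k < 2 ^ a j"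
proof (induction j arbitrary: x)
  case 0
  then show ?case by (auto intro!: exI[of _ 0])
next
  case (Suc j)
  then obtain y c where y: "y \<in> gap_points m a j" "c < 2 ^ (a (Suc j) - m j)" "x = y + real c / 2 ^ a (Suc j)"
    by auto
  from Suc.IH[OF y(1)] obtain k where k: "y = real k / 2 ^ a j" "k < 2 ^ a j" by blast
  have aj: "a j \<le> a (Suc j)" by (rule a_mono) simp
  have "(2::real) ^ a (Suc j) = 2 ^ a j * 2 ^ (a (Suc j) - a j)"
    using aj by (simp flip: power_add)
  then have "y = real (k * 2 ^ (a (Suc j) - a j)) / 2 ^ a (Suc j)"
    by (simp add: k)
  then have "x = real (k * 2 ^ (a (Suc j) - a j) + c) / 2 ^ a (Suc j)"
    by (simp add: y(3) add_divide_distrib)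
  moreover have "c < 2 ^ (a (Suc j) - a j)"
    using y(2) a_le_m[of j] by (meson diff_le_mono2 less_le_trans one_le_numeral power_increasing)
  then have "k * 2 ^ (a (Suc j) - a j) + c < (k + 1) * 2 ^ (a (Suc j) - a j)" by simp
  then have "k * 2 ^ (a (Suc j) - a j) + c < 2 ^ a j * 2 ^ (a (Suc j) - a j)"
    using k(2) by (metis Suc_eq_plus1 Suc_leI less_le_trans mult_le_mono1)
  then have "k * 2 ^ (a (Suc j) - a j) + c < 2 ^ a (Suc j)"
    using aj by (simp flip: power_add)
  ultimately show ?case by blast
qed

text \<open>The step from level n to n + 1 moves a point to the right by at most 1 / 2 ^ m n - 1 / 2
  ^ m (n + 1), and these bounds telescope.\<close>

lemma gap_points_ancestor:
  assumes "j \<le> N" "x \<in> gap_points m a N"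
  shows "\<exists>y\<in>gap_points m a j. y \<le> x \<and> x \<le> y + (1 / 2 ^ m j - 1 / 2 ^ m N)"
  using assms
proof (induction N arbitrary: x rule: dec_induct)
  case (step n)
  then obtain z c where z: "z \<in> gap_points m a n" "c < 2 ^ (a (Suc n) - m n)" "x = z + real c / 2 ^ a (Suc n)"
    by auto
  obtain y where y: "y \<in> gap_points m a j" "y \<le> z" "z \<le> y + (1 / 2 ^ m j - 1 / 2 ^ m n)"
    using step.IH[OF z(1)] by blast
  have "1 / 2 ^ m (Suc n) \<le> (1 / 2 ^ a (Suc n) :: real)"
    by (rule inverse_power_2_mono) (rule a_le_m)
  then have "x \<le> y + (1 / 2 ^ m j - 1 / 2 ^ m (Suc n))"
    using y(3) z(3) digit_le[OF z(2)] by linarith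
  moreover have "y \<le> x" using y z by (simp add: add_increasing2)
  ultimately show ?case using y(1) by blast
qed auto

lemma gap_points_bounds: "x \<in> gap_points m a j \<Longrightarrow> 0 \<le> x \<and> x \<le> 1"
proof -
  assume "x \<in> gap_points m a j"
  then obtain k where k: "x = real k / 2 ^ a j" "k < 2 ^ a j" using gap_points_grid by blast
  then have "real k \<le> 2 ^ a j" by (metis less_imp_le of_nat_le_iff of_nat_numeral of_nat_power)
  with k show ?thesis by (simp add: divide_le_eq)
qed

text \<open>At levels up to \<open>N\<close> the required k comes from the ancestor; at later levels
  the point is itself on the grid, with further digits 0.\<close>

lemma gap_points_subset: "gap_points m a N \<subseteq> gap_cantor m a"
proof
  fix x assume x: "x \<in> gap_points m a N"
  have "\<exists>k::nat. real k / 2 ^ a j \<le> x \<and> x \<le> real k / 2 ^ a j + 1 / 2 ^ m j" for j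
  proof -
    have "\<exists>y\<in>gap_points m a j. y \<le> x \<and> x \<le> y + 1 / 2 ^ m j"
    proof (cases "j \<le> N")
      case True
      then obtain y where "y \<in> gap_points m a j" "y \<le> x" "x \<le> y + (1 / 2 ^ m j - 1 / 2 ^ m N)"
        using gap_points_ancestor[OF True x] by blast
      moreover have "(0::real) \<le> 1 / 2 ^ m N" by simp
      ultimately show ?thesis by (intro bexI[of _ y]) linarith+
    next
      case False
      then have "x \<in> gap_points m a j" using x gap_points_mono[of N j] by auto
      then show ?thesis by (intro bexI[of _ x]) auto
    qed
    then show ?thesis using gap_points_grid by blast
  qed
  then show "x \<in> gap_cantor m a"
    using gap_points_bounds[OF x] by (simp add: gap_cantor_def)
qed

text \<open>Distinct points of level j differ by at least 1 / 2 ^ a j, hence by at least 1 / 2 ^ m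
  j, whereas new digits contribute less than 1 / 2 ^ m j; so no two choices collide.\<close>

lemma card_gap_points_Suc:
  "card (gap_points m a (Suc j)) = card (gap_points m a j) * 2 ^ (a (Suc j) - m j)"
proof -
  have "inj_on (\<lambda>(x, c). x + real c / 2 ^ a (Suc j)) (gap_points m a j \<times> {..<2 ^ (a (Suc j) - m j)})"
  proof (rule inj_onI, clarsimp)
    fix x y and c d :: nat
    assume x: "x \<in> gap_points m a j" and y: "y \<in> gap_points m a j"
      and c: "c < 2 ^ (a (Suc j) - m j)" and d: "d < 2 ^ (a (Suc j) - m j)"
      and eq: "x + real c / 2 ^ a (Suc j) = y + real d / 2 ^ a (Suc j)"
    obtain k l where k: "x = real k / 2 ^ a j" and l: "y = real l / 2 ^ a j"
      using gap_points_grid x y by blast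
    have cd: "real c / 2 ^ a (Suc j) < 1 / 2 ^ m j" "real d / 2 ^ a (Suc j) < 1 / 2 ^ m j"
      using digit_le[OF c] digit_le[OF d] by (smt (verit) divide_pos_pos zero_less_power)+
    have "\<bar>x - y\<bar> < 1 / 2 ^ m j"
      using cd eq by (smt (verit) divide_nonneg_pos of_nat_0_le_iff zero_less_power)
    also have "\<dots> \<le> 1 / 2 ^ a j"
      by (rule inverse_power_2_mono) (rule a_le_m)
    finally have "\<bar>real k - real l\<bar> / 2 ^ a j < 1 / 2 ^ a j"
      by (simp add: k l flip: diff_divide_distrib)
    then have "\<bar>real k - real l\<bar> < 1" by (simp add: divide_less_cancel)
    then have "k = l" by linarith
    then have "x = y" using k l by simp
    moreover have "c = d" using eq \<open>x = y\<close> by simp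
    ultimately show "x = y \<and> c = d" by simp
  qed
  then show ?thesis by (simp add: card_image card_cartesian_product)
qed

lemma card_gap_points_pos: "card (gap_points m a j) > 0"
  by (metis card_gt_0_iff empty_iff finite_gap_points zero_in_gap_points)

lemma card_gap_points_ge: "2 ^ (a (Suc j) - m j) \<le> card (gap_points m a (Suc j))"
  using card_gap_points_pos[of j] by (simp add: card_gap_points_Suc del: gap_points.simps)

end

section \<open>Counting grid points in strips\<close>

text \<open>
  Two close returns with differences \<open>q < D\<close> are multiples of the same fraction as long as
  \<open>2 \<rho> D < 1\<close>, so a single good approximation \<open>p / q\<close> accounts for all returns in a window.
\<close>

lemma card_close_returns_le:
  fixes S :: "nat set" and \<theta> c \<rho> :: real and b0 W K :: nat
  assumes S: "S \<subseteq> {b0..<b0 + W}" and ret: "\<And>b. b \<in> S \<Longrightarrow> \<exists>k::int. c \<le> k + \<theta> * b \<and> k + \<theta> * b \<le> c + \<rho>"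
    and K: "1 \<le> K" and \<rho>: "0 < \<rho>" "2 * \<rho> * W < 1"
    and far: "\<And>(q::nat) (p::int). 1 \<le> q \<Longrightarrow> q \<le> K \<Longrightarrow> \<rho> * K / W < \<bar>\<theta> + p / q\<bar>"
  shows "real (card S) \<le> W / K + 1"
\<comment> \<open>Either all returns are \<open>K\<close> apart, and then there are few of them, or
  some two are closer and yield a small denominator.\<close>
proof (cases "\<forall>x\<in>S. \<forall>y\<in>S. x < y \<longrightarrow> K \<le> y - x")
  case True
  have "inj_on (\<lambda>b. (b - b0) div K) S"
  proof (rule inj_onI, rule ccontr)
    fix x y assume xy: "x \<in> S" "y \<in> S" "(x - b0) div K = (y - b0) div K" "x \<noteq> y"
    have *: False if "x \<in> S" "y \<in> S" "(x - b0) div K = (y - b0) div K" "x < y" for x y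
    proof -
      have "b0 \<le> x" using S that by auto
      have "K \<le> y - x" using True that by blast
      then have "(x - b0) + K \<le> y - b0" using \<open>b0 \<le> x\<close> that by linarith
      then have "((x - b0) + K) div K \<le> (y - b0) div K" by (rule div_le_mono)
      then show False using that K by simp
    qed
    show False using *[of x y] *[of y x] xy by (metis linorder_neqE_nat)
  qed
  moreover have "(\<lambda>b. (b - b0) div K) ` S \<subseteq> {..W div K}"
  proof clarify
    fix b assume "b \<in> S"
    with S have "b \<in> {b0..<b0 + W}" by blast
    then show "(b - b0) div K \<le> W div K" by (intro div_le_mono) auto
  qed
  ultimately have "card S \<le> card {..W div K}"
    by (metis card_inj_on_le finite_atMost)
  then have "real (card S) \<le> real (W div K) + 1"
    by simp
  also have "\<dots> \<le> W / K + 1"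
    using of_nat_div_le_of_nat[of W K] by simp
  finally show ?thesis .
next
  case False
  then obtain x y where xy: "x \<in> S" "y \<in> S" "x < y" "y - x < K" by force
  have fin: "finite S" using S finite_subset by blast
  obtain k where k: "\<And>b. b \<in> S \<Longrightarrow> c \<le> of_int (k b) + \<theta> * b \<and> of_int (k b) + \<theta> * b \<le> c + \<rho>"
    using ret by metis
  have "S \<noteq> {}" using xy by blast
  \<comment> \<open>The extreme elements give the longest difference \<open>D\<close>, so a bound on
    \<open>D\<close> alone will bound the cardinality of \<open>S\<close>.\<close>
  define u v where "u = Min S" and "v = Max S"
  have uv: "u \<in> S" "v \<in> S" "\<And>b. b \<in> S \<Longrightarrow> u \<le> b" "\<And>b. b \<in> S \<Longrightarrow> b \<le> v"
    using fin \<open>S \<noteq> {}\<close> by (auto simp: u_def v_def)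
  define q D where "q = int y - int x" and "D = int v - int u"
  define p e where "p = k y - k x" and "e = k v - k u"
  have q: "1 \<le> q" "q \<le> K"
    using xy(3,4) by (simp_all add: q_def)
  have qD: "q \<le> D"
    using uv(3)[OF xy(1)] uv(4)[OF xy(2)] by (simp add: q_def D_def)
  have DW: "D < W"
    using subsetD[OF S uv(1)] subsetD[OF S uv(2)] by (simp add: D_def)
  have pos: "0 < real_of_int q" "0 < real_of_int D" using q qD by simp_all
  have le: "real_of_int D \<le> W" "real_of_int q \<le> W" using qD DW by linarith+
  have pq: "\<bar>p + \<theta> * q\<bar> \<le> \<rho>"
    using k[OF xy(1)] k[OF xy(2)] by (auto simp: p_def q_def algebra_simps abs_le_iff)
  have eD: "\<bar>e + \<theta> * D\<bar> \<le> \<rho>"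
    using k[OF uv(1)] k[OF uv(2)] by (auto simp: e_def D_def algebra_simps abs_le_iff)
  \<comment> \<open>The determinant of the two approximations does not involve \<theta>. It is an
    integer of modulus at most 2 \<rho> \<open>W\<close> < 1, hence 0.\<close>
  have "real_of_int (p * D - e * q) = (p + \<theta> * q) * D - (e + \<theta> * D) * q"
    by (simp add: algebra_simps)
  then have "\<bar>real_of_int (p * D - e * q)\<bar> \<le> \<bar>p + \<theta> * q\<bar> * D + \<bar>e + \<theta> * D\<bar> * q"
    using pos abs_triangle_ineq4[of "(p + \<theta> * q) * D" "(e + \<theta> * D) * q"] by (simp add: abs_mult)
  also have "\<dots> \<le> \<rho> * D + \<rho> * q"
    by (intro add_mono mult_right_mono pq eD less_imp_le pos)
  also have "\<dots> \<le> \<rho> * W + \<rho> * W"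
    by (intro add_mono mult_left_mono le less_imp_le[OF \<rho>(1)])
  also have "\<dots> < 1" using \<rho>(2) by linarith
  finally have "real_of_int \<bar>p * D - e * q\<bar> < 1" by (simp only: of_int_abs)
  then have "\<bar>p * D - e * q\<bar> < 1" by (simp only: of_int_less_1_iff)
  then have "p * D = e * q" by simp
  then have "real_of_int p * D = e * q" by (metis of_int_mult)
  then have frac: "real_of_int p / q = e / D"
    using pos by (simp add: field_simps)
  \<comment> \<open>The hypothesis applies to p / q because q is small, but the error can be
    evaluated at the equal fraction e / D, where it is at most \<rho> / D. Hence D < W / K.\<close>
  have "\<rho> * K / W < \<bar>\<theta> + p / q\<bar>"
    using far[of "nat q" p] q by (simp add: nat_le_iff le_nat_iff)
  also have "\<dots> = \<bar>e + \<theta> * D\<bar> / D"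
  proof -
    have "\<theta> + e / D = (e + \<theta> * D) / D" using pos by (simp add: field_simps)
    then show ?thesis unfolding frac using pos by simp
  qed
  also have "\<dots> \<le> \<rho> / D" by (intro divide_right_mono eD less_imp_le pos)
  finally have "\<rho> * (real K * real_of_int D) < \<rho> * real W"
    using pos le by (simp add: field_simps)
  then have "real K * real_of_int D < real W" using \<rho> by (simp only: mult_less_cancel_left_pos)
  then have "real_of_int D < W / K" using K by (simp add: field_simps)
  moreover have "S \<subseteq> {u..v}" using uv by auto
  then have "card S \<le> card {u..v}" by (intro card_mono) auto
  then have "real (card S) \<le> real_of_int D + 1" using qD q by (auto simp: D_def)
  ultimately show ?thesis by linarith
qed

lemma of_nat_le_sum: "n \<le> (\<Sum>i\<in>A. f i) \<Longrightarrow> real n \<le> (\<Sum>i\<in>A. real (f i))"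
  by (drule of_nat_mono) (simp only: of_nat_sum)

text \<open>The integrality argument needs 2 \<rho> times the length below 1, which may fail on the
  whole range. It is therefore applied separately in 2 ^ (n - w) windows of length 2 ^ w.\<close>

lemma card_close_returns_windows_le:
  fixes S :: "nat set" and \<theta> c \<rho> :: real and w n K :: nat
  assumes S: "S \<subseteq> {..<2 ^ n}" and w: "w \<le> n"
    and ret: "\<And>b. b \<in> S \<Longrightarrow> \<exists>k::int. c \<le> k + \<theta> * b \<and> k + \<theta> * b \<le> c + \<rho>"
    and K: "1 \<le> K" and \<rho>: "0 < \<rho>" "2 * \<rho> * 2 ^ w < 1"
    and far: "\<And>(q::nat) (p::int). 1 \<le> q \<Longrightarrow> q \<le> K \<Longrightarrow> \<rho> * K / 2 ^ w < \<bar>\<theta> + p / q\<bar>"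
  shows "real (card S) \<le> 2 ^ (n - w) * (2 ^ w / K + 1)"
proof -
  let ?T = "\<lambda>i. S \<inter> {i * 2 ^ w..<i * 2 ^ w + 2 ^ w}"
  have "S \<subseteq> (\<Union>i<2 ^ (n - w). ?T i)"
  proof
    fix b assume b: "b \<in> S"
    then have "b < 2 ^ n" using S by auto
    then have "b < 2 ^ (n - w) * 2 ^ w" using w by (simp flip: power_add)
    then have "b div 2 ^ w < 2 ^ (n - w)" by (simp add: less_mult_imp_div_less)
    moreover have "b div 2 ^ w * 2 ^ w \<le> b" "b < b div 2 ^ w * 2 ^ w + 2 ^ w"
      using div_mult_mod_eq[of b "2 ^ w"] mod_less_divisor[of "2 ^ w" b, OF zero_less_power] by linarith+
    ultimately show "b \<in> (\<Union>i<2 ^ (n - w). ?T i)"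
      using b by (intro UN_I[of "b div 2 ^ w"]) auto
  qed
  then have "card S \<le> card (\<Union>i<2 ^ (n - w). ?T i)"
    by (intro card_mono) auto
  also have "\<dots> \<le> (\<Sum>i<2 ^ (n - w). card (?T i))" by (rule card_UN_le) simp
  finally have "real (card S) \<le> (\<Sum>i<2 ^ (n - w). real (card (?T i)))"
    by (rule of_nat_le_sum)
  also have "\<dots> \<le> (\<Sum>i<(2::nat) ^ (n - w). real (2 ^ w) / K + 1)"
    by (intro sum_mono card_close_returns_le[where \<theta> = \<theta> and c = c and \<rho> = \<rho>])
      (use assms in auto)
  also have "\<dots> = 2 ^ (n - w) * (2 ^ w / K + 1)" by simp
  finally show ?thesis .
qed

section \<open>Strips in the product grid and their behaviour under refinement\<close>

locale gap_strips = A: gap_scales m a + B: gap_scales m b for m a b :: "nat \<Rightarrow> nat" +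
  fixes \<theta> :: real
begin

definition strip :: "nat \<Rightarrow> real \<Rightarrow> real \<Rightarrow> (real \<times> real) set" where
  "strip j l r = {(x, y) \<in> gap_points m a j \<times> gap_points m b j. l \<le> x + \<theta> * y \<and> x + \<theta> * y \<le> l + r}"

definition total :: "nat \<Rightarrow> real" where
  "total j = real (card (gap_points m a j) * card (gap_points m b j))"

text \<open>The variation of x + \<theta> y over a square of side 1 / 2 ^ m j, hence a bound for how
  far a descendant of a level j point can move in the projection.\<close>

definition width :: "nat \<Rightarrow> real" where
  "width j = (1 + \<bar>\<theta>\<bar>) / 2 ^ m j"

lemma finite_strip [simp]: "finite (strip j l r)"
  by (rule finite_subset[of _ "gap_points m a j \<times> gap_points m b j"]) (auto simp: strip_def)

lemma strip_mono: "l' \<le> l \<Longrightarrow> l + r \<le> l' + r' \<Longrightarrow> strip j l r \<subseteq> strip j l' r'"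
  by (auto simp: strip_def)

lemma card_strip_mono: "l' \<le> l \<Longrightarrow> l + r \<le> l' + r' \<Longrightarrow> card (strip j l r) \<le> card (strip j l' r')"
  by (intro card_mono strip_mono) auto

lemma card_strip_le_total: "real (card (strip j l r)) \<le> total j"
proof -
  have "card (strip j l r) \<le> card (gap_points m a j \<times> gap_points m b j)"
    by (intro card_mono) (auto simp: strip_def)
  then show ?thesis by (simp add: total_def card_cartesian_product flip: of_nat_mult)
qed

lemma total_pos: "0 < total j"
  using A.card_gap_points_pos B.card_gap_points_pos by (simp add: total_def)

lemma total_Suc: "total (Suc j) = total j * 2 ^ (a (Suc j) - m j) * 2 ^ (b (Suc j) - m j)"
  by (simp add: total_def A.card_gap_points_Suc B.card_gap_points_Suc del: gap_points.simps)

text \<open>A child differs from its parent by at most \<delta> in x + \<theta> y, so the parent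
  lies in the strip widened by \<delta> on both sides; \<open>M\<close> bounds the children of a
  single parent that hit the strip. The subtracted term in \<delta> is kept for telescoping.\<close>

lemma card_strip_Suc_le:
  fixes M :: real and j :: nat
  defines "\<delta> \<equiv> (1 + \<bar>\<theta>\<bar>) * (1 / 2 ^ m j - 1 / 2 ^ m (Suc j))"
  assumes M: "\<And>l. real (card {(c, d). c < 2 ^ (a (Suc j) - m j) \<and> d < 2 ^ (b (Suc j) - m j) \<and>
      l \<le> real c / 2 ^ a (Suc j) + \<theta> * (real d / 2 ^ b (Suc j)) \<and>
      real c / 2 ^ a (Suc j) + \<theta> * (real d / 2 ^ b (Suc j)) \<le> l + r}) \<le> M"
  shows "real (card (strip (Suc j) l r)) \<le> M * card (strip j (l - \<delta>) (r + 2 * \<delta>))"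
proof -
  define F where "F l = {(c::nat, d::nat). c < 2 ^ (a (Suc j) - m j) \<and> d < 2 ^ (b (Suc j) - m j) \<and>
      l \<le> real c / 2 ^ a (Suc j) + \<theta> * (real d / 2 ^ b (Suc j)) \<and>
      real c / 2 ^ a (Suc j) + \<theta> * (real d / 2 ^ b (Suc j)) \<le> l + r}" for l
  have finF: "finite (F l)" for l
    by (rule finite_subset[of _ "{..<2 ^ (a (Suc j) - m j)} \<times> {..<2 ^ (b (Suc j) - m j)}"])
      (auto simp: F_def)
  let ?S = "strip j (l - \<delta>) (r + 2 * \<delta>)"
  let ?h = "\<lambda>((x, y), (c, d)). (x + real c / 2 ^ a (Suc j), y + real d / 2 ^ b (Suc j))"
  have sub: "strip (Suc j) l r \<subseteq> ?h ` (SIGMA z:?S. F (l - (fst z + \<theta> * snd z)))"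
  proof
    fix z assume z: "z \<in> strip (Suc j) l r"
    obtain x' y' where z': "z = (x', y')" by fastforce
    obtain x c where x: "x \<in> gap_points m a j" "c < 2 ^ (a (Suc j) - m j)" "x' = x + real c / 2 ^ a (Suc j)"
      using z by (auto simp: strip_def z')
    obtain y d where y: "y \<in> gap_points m b j" "d < 2 ^ (b (Suc j) - m j)" "y' = y + real d / 2 ^ b (Suc j)"
      using z by (auto simp: strip_def z')
    have I: "l \<le> x' + \<theta> * y'" "x' + \<theta> * y' \<le> l + r"
      using z by (auto simp: strip_def z')
    define E :: real where "E = 1 / 2 ^ m j - 1 / 2 ^ m (Suc j)"
    have c: "0 \<le> real c / 2 ^ a (Suc j)" "real c / 2 ^ a (Suc j) \<le> E"
      using A.digit_le[OF x(2)] inverse_power_2_mono[OF A.a_le_m[of "Suc j"]] by (auto simp: E_def)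
    have d: "0 \<le> real d / 2 ^ b (Suc j)" "real d / 2 ^ b (Suc j) \<le> E"
      using B.digit_le[OF y(2)] inverse_power_2_mono[OF B.a_le_m[of "Suc j"]] by (auto simp: E_def)
    have "\<bar>\<theta> * (real d / 2 ^ b (Suc j))\<bar> \<le> \<bar>\<theta>\<bar> * E"
      unfolding abs_mult using d by (intro mult_left_mono) auto
    moreover have "\<delta> = E + \<bar>\<theta>\<bar> * E" by (simp add: \<delta>_def E_def distrib_right)
    ultimately have "\<bar>real c / 2 ^ a (Suc j) + \<theta> * (real d / 2 ^ b (Suc j))\<bar> \<le> \<delta>"
      using c by linarith
    moreover have "x' + \<theta> * y' = (x + \<theta> * y) + (real c / 2 ^ a (Suc j) + \<theta> * (real d / 2 ^ b (Suc j)))"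
      by (simp add: x y algebra_simps)
    ultimately have "l - \<delta> \<le> x + \<theta> * y" "x + \<theta> * y \<le> l - \<delta> + (r + 2 * \<delta>)"
      "l - (x + \<theta> * y) \<le> real c / 2 ^ a (Suc j) + \<theta> * (real d / 2 ^ b (Suc j))"
      "real c / 2 ^ a (Suc j) + \<theta> * (real d / 2 ^ b (Suc j)) \<le> l - (x + \<theta> * y) + r"
      using I by linarith+
    then have "(x, y) \<in> ?S" "(c, d) \<in> F (l - (x + \<theta> * y))"
      using x(1,2) y(1,2) by (simp_all add: strip_def F_def)
    then show "z \<in> ?h ` (SIGMA z:?S. F (l - (fst z + \<theta> * snd z)))"
      by (intro image_eqI[of _ _ "((x, y), (c, d))"]) (simp_all add: z' x(3) y(3))
  qed
  have "card (strip (Suc j) l r) \<le> card (SIGMA z:?S. F (l - (fst z + \<theta> * snd z)))"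
    by (rule surj_card_le[OF _ sub]) (auto intro!: finite_SigmaI finF)
  also have "\<dots> = (\<Sum>z\<in>?S. card (F (l - (fst z + \<theta> * snd z))))"
    by (rule card_SigmaI) (auto simp: finF)
  finally have "real (card (strip (Suc j) l r)) \<le> (\<Sum>z\<in>?S. real (card (F (l - (fst z + \<theta> * snd z)))))"
    by (rule of_nat_le_sum)
  also have "\<dots> \<le> (\<Sum>z\<in>?S. M)"
    using M by (intro sum_mono) (simp add: F_def)
  also have "\<dots> = M * card ?S" by simp
  finally show ?thesis .
qed

lemma card_strip_parent_le:
  "real (card (strip (Suc n) l r)) \<le> 2 ^ (a (Suc n) - m n) * 2 ^ (b (Suc n) - m n) *
     real (card (strip n (l - (width n - width (Suc n))) (r + 2 * (width n - width (Suc n)))))"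
proof -
  define M :: real where "M = 2 ^ (a (Suc n) - m n) * 2 ^ (b (Suc n) - m n)"
  have w: "width n - width (Suc n) = (1 + \<bar>\<theta>\<bar>) * (1 / 2 ^ m n - 1 / 2 ^ m (Suc n))"
    unfolding width_def right_diff_distrib by simp
  have "real (card (strip (Suc n) l r)) \<le> M * card (strip n (l - (1 + \<bar>\<theta>\<bar>) * (1 / 2 ^ m n - 1 / 2 ^ m (Suc n)))
      (r + 2 * ((1 + \<bar>\<theta>\<bar>) * (1 / 2 ^ m n - 1 / 2 ^ m (Suc n)))))"
  proof (rule card_strip_Suc_le)
    fix l :: real
    have "real (card {(c::nat, d::nat). c < 2 ^ (a (Suc n) - m n) \<and> d < 2 ^ (b (Suc n) - m n) \<and>
        l \<le> real c / 2 ^ a (Suc n) + \<theta> * (real d / 2 ^ b (Suc n)) \<and>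
        real c / 2 ^ a (Suc n) + \<theta> * (real d / 2 ^ b (Suc n)) \<le> l + r})
        \<le> real (card ({..<2 ^ (a (Suc n) - m n)::nat} \<times> {..<2 ^ (b (Suc n) - m n)::nat}))"
      by (intro of_nat_mono card_mono) auto
    also have "\<dots> = M" by (simp add: M_def card_cartesian_product)
    finally show "real (card {(c::nat, d::nat). c < 2 ^ (a (Suc n) - m n) \<and> d < 2 ^ (b (Suc n) - m n) \<and>
        l \<le> real c / 2 ^ a (Suc n) + \<theta> * (real d / 2 ^ b (Suc n)) \<and>
        real c / 2 ^ a (Suc n) + \<theta> * (real d / 2 ^ b (Suc n)) \<le> l + r}) \<le> M" .
  qed
  then show ?thesis unfolding w M_def .
qed

text \<open>The proportion of grid points in a strip is compared with that at an ancestor level,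
  written without division. At each step all children of a parent are counted, and the widenings
  telescope to \<open>width j - width (j + n)\<close> on each side.\<close>

lemma card_strip_ancestor_le_aux:
  "real (card (strip (j + n) l r)) * total j \<le> total (j + n) *
     card (strip j (l - (width j - width (j + n))) (r + 2 * (width j - width (j + n))))"
proof (induction n arbitrary: l r)
  case (Suc n)
  define \<delta> where "\<delta> = width (j + n) - width (Suc (j + n))"
  define M :: real where "M = 2 ^ (a (Suc (j + n)) - m (j + n)) * 2 ^ (b (Suc (j + n)) - m (j + n))"
  have "real (card (strip (Suc (j + n)) l r)) * total j \<le> M * real (card (strip (j + n) (l - \<delta>) (r + 2 * \<delta>))) * total j"
    unfolding M_def \<delta>_def by (rule mult_right_mono[OF card_strip_parent_le less_imp_le[OF total_pos]])
  also have "\<dots> = M * (real (card (strip (j + n) (l - \<delta>) (r + 2 * \<delta>))) * total j)"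
    by (rule mult.assoc)
  also have "\<dots> \<le> M * (total (j + n) * card (strip j (l - \<delta> - (width j - width (j + n)))
      (r + 2 * \<delta> + 2 * (width j - width (j + n)))))"
    by (rule mult_left_mono[OF Suc.IH]) (simp add: M_def)
  also have "\<dots> = total (Suc (j + n)) * card (strip j (l - \<delta> - (width j - width (j + n)))
      (r + 2 * \<delta> + 2 * (width j - width (j + n))))"
    by (simp only: total_Suc M_def mult_ac)
  also have "l - \<delta> - (width j - width (j + n)) = l - (width j - width (Suc (j + n)))"
    by (simp add: \<delta>_def)
  also have "r + 2 * \<delta> + 2 * (width j - width (j + n)) = r + 2 * (width j - width (Suc (j + n)))"
    by (simp add: \<delta>_def)
  finally show ?case by (simp only: add_Suc_right)
qed (simp add: mult.commute)

lemma card_strip_ancestor_le: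
  assumes "j \<le> N"
  shows "real (card (strip N l r)) * total j \<le> total N * card (strip j (l - width j) (r + 2 * width j))"
proof -
  obtain n where N: "N = j + n" using assms le_Suc_ex by blast
  have "0 \<le> width N" by (simp add: width_def)
  then have "card (strip j (l - (width j - width N)) (r + 2 * (width j - width N))) \<le>
      card (strip j (l - width j) (r + 2 * width j))"
    by (intro card_strip_mono) auto
  then have "total N * card (strip j (l - (width j - width N)) (r + 2 * (width j - width N))) \<le>
      total N * card (strip j (l - width j) (r + 2 * width j))"
    using total_pos[of N] by (intro mult_left_mono of_nat_mono) auto
  then show ?thesis
    using card_strip_ancestor_le_aux[of j n l r] unfolding N by linarith
qed

text \<open>For a fixed parent and a fixed second digit block d, the first block c ranges over
  integers in an interval of length r * 2 ^ a (j + 1). Compared with counting all children this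
  gains when r is smaller than 1 / 2 ^ m j.\<close>

lemma card_strip_Suc_le':
  assumes "0 \<le> r"
  shows "real (card (strip (Suc j) l r)) \<le>
    2 ^ (b (Suc j) - m j) * (r * 2 ^ a (Suc j) + 1) * card (strip j (l - width j) (r + 2 * width j))"
proof -
  define \<delta> where "\<delta> = (1 + \<bar>\<theta>\<bar>) * (1 / 2 ^ m j - 1 / 2 ^ m (Suc j))"
  define M where "M = 2 ^ (b (Suc j) - m j) * (r * 2 ^ a (Suc j) + 1)"
  have "real (card (strip (Suc j) l r)) \<le> M * card (strip j (l - \<delta>) (r + 2 * \<delta>))"
    unfolding \<delta>_def
  proof (rule card_strip_Suc_le)
    fix l :: real
    define G where "G d = {c::nat. (l - \<theta> * (real d / 2 ^ b (Suc j))) * 2 ^ a (Suc j) \<le> real c \<and>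
      real c \<le> (l - \<theta> * (real d / 2 ^ b (Suc j))) * 2 ^ a (Suc j) + r * 2 ^ a (Suc j)}" for d :: nat
    have G: "finite (G d)" "real (card (G d)) \<le> r * 2 ^ a (Suc j) + 1" for d
      unfolding G_def using assms by (intro card_nat_interval_le; simp)+
    have "card {(c::nat, d::nat). c < 2 ^ (a (Suc j) - m j) \<and> d < 2 ^ (b (Suc j) - m j) \<and>
        l \<le> real c / 2 ^ a (Suc j) + \<theta> * (real d / 2 ^ b (Suc j)) \<and>
        real c / 2 ^ a (Suc j) + \<theta> * (real d / 2 ^ b (Suc j)) \<le> l + r}
      \<le> card (SIGMA d:{..<2 ^ (b (Suc j) - m j)}. G d)"
    proof (rule surj_card_le[where f = prod.swap])
      show "{(c::nat, d::nat). c < 2 ^ (a (Suc j) - m j) \<and> d < 2 ^ (b (Suc j) - m j) \<and>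
        l \<le> real c / 2 ^ a (Suc j) + \<theta> * (real d / 2 ^ b (Suc j)) \<and>
        real c / 2 ^ a (Suc j) + \<theta> * (real d / 2 ^ b (Suc j)) \<le> l + r}
        \<subseteq> prod.swap ` (SIGMA d:{..<2 ^ (b (Suc j) - m j)}. G d)"
      proof clarify
        fix c d :: nat
        define s where "s = \<theta> * (real d / 2 ^ b (Suc j))"
        assume "d < 2 ^ (b (Suc j) - m j)"
          "l \<le> real c / 2 ^ a (Suc j) + \<theta> * (real d / 2 ^ b (Suc j))"
          "real c / 2 ^ a (Suc j) + \<theta> * (real d / 2 ^ b (Suc j)) \<le> l + r"
        then have "d < 2 ^ (b (Suc j) - m j)" "l - s \<le> real c / 2 ^ a (Suc j)"
          "real c / 2 ^ a (Suc j) \<le> (l - s) + r" by (auto simp: s_def)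
        then have "d < 2 ^ (b (Suc j) - m j)" "c \<in> G d"
          unfolding G_def s_def[symmetric] by (auto simp: pos_le_divide_eq pos_divide_le_eq distrib_right)
        then show "(c, d) \<in> prod.swap ` (SIGMA d:{..<2 ^ (b (Suc j) - m j)}. G d)"
          by (intro image_eqI[of _ _ "(d, c)"]) auto
      qed
    qed (auto simp: G)
    also have "\<dots> = (\<Sum>d<2 ^ (b (Suc j) - m j). card (G d))"
      by (rule card_SigmaI) (auto simp: G)
    finally have "real (card {(c::nat, d::nat). c < 2 ^ (a (Suc j) - m j) \<and> d < 2 ^ (b (Suc j) - m j) \<and>
        l \<le> real c / 2 ^ a (Suc j) + \<theta> * (real d / 2 ^ b (Suc j)) \<and>
        real c / 2 ^ a (Suc j) + \<theta> * (real d / 2 ^ b (Suc j)) \<le> l + r})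
      \<le> (\<Sum>d<2 ^ (b (Suc j) - m j). real (card (G d)))"
      by (rule of_nat_le_sum)
    also have "\<dots> \<le> (\<Sum>d<2 ^ (b (Suc j) - m j)::nat. r * 2 ^ a (Suc j) + 1)"
      by (intro sum_mono G)
    also have "\<dots> = M" by (simp add: M_def)
    finally show "real (card {(c::nat, d::nat). c < 2 ^ (a (Suc j) - m j) \<and> d < 2 ^ (b (Suc j) - m j) \<and>
        l \<le> real c / 2 ^ a (Suc j) + \<theta> * (real d / 2 ^ b (Suc j)) \<and>
        real c / 2 ^ a (Suc j) + \<theta> * (real d / 2 ^ b (Suc j)) \<le> l + r}) \<le> M" .
  qed
  also have "\<dots> \<le> M * card (strip j (l - width j) (r + 2 * width j))"
  proof (intro mult_left_mono of_nat_mono card_strip_mono)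
    have "0 \<le> (1 + \<bar>\<theta>\<bar>) * (1 / 2 ^ m (Suc j))" by simp
    moreover have "\<delta> = width j - (1 + \<bar>\<theta>\<bar>) * (1 / 2 ^ m (Suc j))"
      unfolding \<delta>_def width_def right_diff_distrib by simp
    ultimately show "l - width j \<le> l - \<delta>" "l - \<delta> + (r + 2 * \<delta>) \<le> l - width j + (r + 2 * width j)"
      by linarith+
    show "0 \<le> M" using assms by (simp add: M_def)
  qed
  finally show ?thesis by (simp add: M_def)
qed

end

context gap_strips
begin

text \<open>Multiplication by 2 ^ a j turns x + \<theta> y into i + (\<theta> * 2 ^ g) k with
  integers i and k, where y = k / 2 ^ b j. Since r * 2 ^ a j < 1, a value of y admits at most one x
  in the strip, so its points are close returns of k.\<close>

lemma card_strip_far_le: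
  fixes K :: nat and l r :: real
  assumes a: "a j = b j + g" and w: "w \<le> b j" and K: "1 \<le> K"
    and r: "0 < r" "2 * (r * 2 ^ a j) * 2 ^ w < 1"
    and far: "\<And>(q::nat) (p::int). 1 \<le> q \<Longrightarrow> q \<le> K \<Longrightarrow> (r * 2 ^ a j) * K / 2 ^ w < \<bar>\<theta> * 2 ^ g + p / q\<bar>"
  shows "real (card (strip j l r)) \<le> 2 ^ (b j - w) * (2 ^ w / K + 1)"
proof -
  define S where "S = {k. k < 2 ^ b j \<and> (\<exists>i::int. l * 2 ^ a j \<le> i + (\<theta> * 2 ^ g) * real k \<and>
      i + (\<theta> * 2 ^ g) * real k \<le> l * 2 ^ a j + r * 2 ^ a j)}"
  have fl: "nat \<lfloor>real k / 2 ^ b j * 2 ^ b j\<rfloor> = k" for k by simp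
  have "inj_on (\<lambda>(x, y). nat \<lfloor>y * 2 ^ b j\<rfloor>) (strip j l r)"
  proof (rule inj_onI, clarify)
    fix x y x' y'
    assume z: "(x, y) \<in> strip j l r" and z': "(x', y') \<in> strip j l r"
      and eq: "nat \<lfloor>y * 2 ^ b j\<rfloor> = nat \<lfloor>y' * 2 ^ b j\<rfloor>"
    obtain k k' where k: "y = real k / 2 ^ b j" "y' = real k' / 2 ^ b j"
      using z z' B.gap_points_grid by (fastforce simp: strip_def)
    then have "k = k'" using eq by simp
    then have y: "y = y'" using k by simp
    obtain i i' where i: "x = real i / 2 ^ a j" "x' = real i' / 2 ^ a j"
      using z z' A.gap_points_grid by (fastforce simp: strip_def)
    have "l \<le> x + \<theta> * y" "x + \<theta> * y \<le> l + r" "l \<le> x' + \<theta> * y" "x' + \<theta> * y \<le> l + r"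
      using z z' y by (simp_all add: strip_def)
    then have "\<bar>x - x'\<bar> \<le> r" by linarith
    then have "\<bar>x - x'\<bar> * 2 ^ a j \<le> r * 2 ^ a j" by (rule mult_right_mono) simp
    moreover have "\<bar>x - x'\<bar> * 2 ^ a j = \<bar>real i - real i'\<bar>"
      by (simp add: i flip: diff_divide_distrib)
    moreover have "r * 2 ^ a j < 1"
    proof -
      have "(1::real) \<le> 2 ^ w" by simp
      then have "2 * (r * 2 ^ a j) * 1 \<le> 2 * (r * 2 ^ a j) * 2 ^ w"
        using r(1) by (intro mult_left_mono) auto
      then show ?thesis using r by linarith
    qed
    ultimately have "\<bar>real i - real i'\<bar> < 1" by linarith
    then have "i = i'" by linarith
    then show "x = x' \<and> y = y'" using i y by simp
  qed
  moreover have "(\<lambda>(x, y). nat \<lfloor>y * 2 ^ b j\<rfloor>) ` strip j l r \<subseteq> S"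
  proof clarify
    fix x y assume z: "(x, y) \<in> strip j l r"
    obtain k where k: "y = real k / 2 ^ b j" "k < 2 ^ b j"
      using z B.gap_points_grid by (fastforce simp: strip_def)
    obtain i where i: "x = real i / 2 ^ a j"
      using z A.gap_points_grid by (fastforce simp: strip_def)
    have e: "(x + \<theta> * y) * 2 ^ a j = real_of_int (int i) + (\<theta> * 2 ^ g) * real k"
      by (simp add: k i a power_add field_simps)
    have "l * 2 ^ a j \<le> (x + \<theta> * y) * 2 ^ a j" "(x + \<theta> * y) * 2 ^ a j \<le> (l + r) * 2 ^ a j"
      using z by (auto simp: strip_def intro!: mult_right_mono)
    then have "k \<in> S" unfolding S_def e using k(2) by (auto simp: distrib_right intro!: exI[of _ "int i"])
    then show "nat \<lfloor>y * 2 ^ b j\<rfloor> \<in> S" by (simp add: k(1))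
  qed
  moreover have fin: "finite S" by (rule finite_subset[of _ "{..<2 ^ b j}"]) (auto simp: S_def)
  ultimately have "card (strip j l r) \<le> card S" by (rule card_inj_on_le)
  also have "real (card S) \<le> 2 ^ (b j - w) * (2 ^ w / K + 1)"
    by (rule card_close_returns_windows_le[where \<theta> = "\<theta> * 2 ^ g" and \<rho> = "r * 2 ^ a j" and c = "l * 2 ^ a j"])
      (use w K r far in \<open>auto simp: S_def\<close>)
  finally show ?thesis by simp
qed

text \<open>
  At widths above \<open>2 ^ e (j + 1) / 2 ^ m (j + 1)\<close> the grid of level \<open>j + 1\<close> is so fine that the number of
  its points in a strip is essentially proportional to the width, so that the bound is inherited
  from level \<open>j\<close>; at smaller widths the bound of level \<open>j + 1\<close> applies by monotonicity.
\<close>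

lemma card_strip_frostman:
  fixes t :: real and e :: "nat \<Rightarrow> nat" and j0 :: nat
  assumes t: "0 < t" "t \<le> 1"
    and level: "\<And>j l. j0 \<le> j \<Longrightarrow>
      real (card (strip j l (5 * (1 + \<bar>\<theta>\<bar>) * 2 ^ e j / 2 ^ m j))) \<le> total j * (1 / 2 ^ m j) powr t"
    and fine: "\<And>j. j0 \<le> j \<Longrightarrow> 2 ^ m j / 2 ^ a (Suc j) \<le> (2 ^ e (Suc j) / 2 ^ m (Suc j)) powr t"
  shows "\<exists>C>0. \<forall>N\<ge>j0. \<forall>l r. 1 / 2 ^ m N \<le> r \<longrightarrow> real (card (strip N l r)) \<le> C * total N * r powr t"
proof -
  define \<Theta> where "\<Theta> = 1 + \<bar>\<theta>\<bar>"
  have \<Theta>: "1 \<le> \<Theta>" by (simp add: \<Theta>_def)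
  have width: "width j = \<Theta> * (1 / 2 ^ m j)" for j by (simp add: width_def \<Theta>_def)
  \<comment> \<open>The first entry makes the bound trivial for r of size at least 1 / 2 ^ m j0; the
    second is the constant found at smaller r.\<close>
  define C where "C = max (2 ^ m j0) (3 * \<Theta> + 1)"
  have C: "0 < C" "1 \<le> C" using \<Theta> by (auto simp: C_def)
  have "real (card (strip N l r)) \<le> C * total N * r powr t" if N: "j0 \<le> N" and r: "1 / 2 ^ m N \<le> r" for N l r
  proof -
    have r0: "0 < r" using r by (smt (verit) divide_pos_pos zero_less_power)
    \<comment> \<open>The first level whose cells are not longer than r; the preceding level j then
      has cells longer than r, and both bounds on r are used.\<close>
    define i where "i = (LEAST i. 1 / 2 ^ m i \<le> r)"
    have i: "1 / 2 ^ m i \<le> r" unfolding i_def using r by (rule LeastI)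
    have "i \<le> N" unfolding i_def using r by (rule Least_le)
    show ?thesis
    proof (cases "i \<le> j0")
      case True
      have "1 / 2 ^ m j0 \<le> (1 / 2 ^ m i :: real)"
        by (intro inverse_power_2_mono A.m_mono True)
      then have rj: "1 / 2 ^ m j0 \<le> r" using i by linarith
      have "1 \<le> C * r powr t"
      proof (cases "1 \<le> r")
        case True
        then have "1 \<le> r powr t" using t by (simp add: ge_one_powr_ge_zero)
        then have "1 * 1 \<le> C * r powr t" using C by (intro mult_mono) auto
        then show ?thesis by simp
      next
        case False
        then have "r powr 1 \<le> r powr t" using t r0 by (intro powr_mono') auto
        then have "1 / 2 ^ m j0 \<le> r powr t" using rj r0 by simp
        then have "2 ^ m j0 * (1 / 2 ^ m j0) \<le> C * r powr t"
          using C by (intro mult_mono) (auto simp: C_def)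
        then show ?thesis by simp
      qed
      then have "total N * 1 \<le> total N * (C * r powr t)"
        using total_pos[of N] by (intro mult_left_mono) auto
      then show ?thesis using card_strip_le_total[of N l r] by (simp add: mult_ac)
    next
      case False
      then obtain j where j: "i = Suc j" "j0 \<le> j" by (cases i) auto
      have rj: "r < 1 / 2 ^ m j"
        using not_less_Least[of j "\<lambda>i. 1 / 2 ^ m i \<le> r"] j(1) unfolding i_def by (simp add: not_le)
      have red: "real (card (strip N l r)) * total i \<le> total N * card (strip i (l - width i) (r + 2 * width i))"
        by (rule card_strip_ancestor_le) (rule \<open>i \<le> N\<close>)
      have wi: "width i \<le> \<Theta> * r"
        unfolding width using i \<Theta> by (intro mult_left_mono) auto
      have rr: "r \<le> \<Theta> * r" using r0 \<Theta> by (simp add: mult_le_cancel_right1)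
      have "real (card (strip i (l - width i) (r + 2 * width i))) \<le> total i * ((3 * \<Theta> + 1) * r powr t)"
      proof (cases "r \<le> 2 ^ e i / 2 ^ m i")
        case True
        have "r + 2 * width i \<le> 5 * \<Theta> * 2 ^ e i / 2 ^ m i"
        proof -
          have "\<Theta> * r \<le> \<Theta> * (2 ^ e i / 2 ^ m i)"
            using True \<Theta> by (intro mult_left_mono) auto
          moreover have "0 \<le> \<Theta> * (2 ^ e i / 2 ^ m i)" using \<Theta> by simp
          ultimately show ?thesis using wi rr by simp
        qed
        then have "card (strip i (l - width i) (r + 2 * width i)) \<le>
            card (strip i (l - width i) (5 * \<Theta> * 2 ^ e i / 2 ^ m i))"
          by (intro card_strip_mono) auto
        also have "real \<dots> \<le> total i * (1 / 2 ^ m i) powr t"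
          using level[of i "l - width i"] j by (simp add: \<Theta>_def)
        also have "\<dots> \<le> total i * r powr t"
          using i t total_pos[of i] by (intro mult_left_mono powr_mono2) auto
        also have "\<dots> \<le> total i * ((3 * \<Theta> + 1) * r powr t)"
          using total_pos[of i] \<Theta> by (intro mult_left_mono) (auto simp: mult_le_cancel_right1)
        finally show ?thesis by simp
      next
        case False
        define R where "R = r + 2 * width i"
        have "0 \<le> width i" by (simp add: width_def)
        then have R: "0 \<le> R" "R \<le> 3 * \<Theta> * r"
          unfolding R_def using wi rr r0 by linarith+
        have "real (card (strip i (l - width i) R)) \<le> 2 ^ (b i - m j) * (R * 2 ^ a i + 1) *
            card (strip j (l - width i - width j) (R + 2 * width j))"
          unfolding j(1) by (rule card_strip_Suc_le') (rule R)
        also have "\<dots> \<le> 2 ^ (b i - m j) * (3 * \<Theta> * r * 2 ^ a i + 1) * (total j * (1 / 2 ^ m j) powr t)"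
        proof (intro mult_mono add_mono order_refl mult_right_mono R)
          have "\<Theta> * r \<le> width j" unfolding width using rj \<Theta> by (intro mult_left_mono) auto
          moreover have "width j * 1 \<le> width j * 2 ^ e j"
            by (intro mult_left_mono) (simp_all add: width_def)
          \<comment> \<open>This produces the 5 of the hypothesis \<open>level\<close>: widening at
            level i makes at most 3 \<open>width j\<close>, and passing to the parent level adds 2
            more.\<close>
          ultimately have "R + 2 * width j \<le> 5 * (width j * 2 ^ e j)" using R by linarith
          then have "R + 2 * width j \<le> 5 * \<Theta> * 2 ^ e j / 2 ^ m j" by (simp add: width)
          then have "card (strip j (l - width i - width j) (R + 2 * width j)) \<le>
             card (strip j (l - width i - width j) (5 * \<Theta> * 2 ^ e j / 2 ^ m j))"
            by (intro card_strip_mono) auto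
          also have "real \<dots> \<le> total j * (1 / 2 ^ m j) powr t"
            using level[of j "l - width i - width j"] j by (simp add: \<Theta>_def)
          finally show "real (card (strip j (l - width i - width j) (R + 2 * width j))) \<le> total j * (1 / 2 ^ m j) powr t"
            by simp
        qed (use \<Theta> r0 R(1) in \<open>auto intro!: add_nonneg_nonneg mult_nonneg_nonneg\<close>)
        also have "\<dots> = total i * ((3 * \<Theta> * (r * 2 ^ m j) + 2 ^ m j / 2 ^ a i) * (1 / 2 ^ m j) powr t)"
        proof -
          have "(2::real) ^ a i = 2 ^ (a i - m j) * 2 ^ m j"
            using A.m_le_a[of j] j(1) by (simp flip: power_add)
          then show ?thesis unfolding j(1) total_Suc by (simp add: j(1)[symmetric] field_simps)
        qed
        also have "\<dots> \<le> total i * (3 * \<Theta> * r powr t + r powr t)"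
        proof (rule mult_left_mono)
          \<comment> \<open>Linear growth of the count in r beats the power because r * 2 ^ m j < 1
            and t \<le> 1. The additive 1 from rounding becomes the term 2 ^ m j / 2 ^ a i, which
            \<open>fine\<close> controls.\<close>
          have "(r * 2 ^ m j) powr 1 \<le> (r * 2 ^ m j) powr t"
            using t r0 rj by (intro powr_mono') (auto simp: pos_less_divide_eq)
          then have "r * 2 ^ m j \<le> (r * 2 ^ m j) powr t" using r0 by simp
          then have "(r * 2 ^ m j) * (1 / 2 ^ m j) powr t \<le> (r * 2 ^ m j) powr t * (1 / 2 ^ m j) powr t"
            by (rule mult_right_mono) simp
          also have "\<dots> = r powr t" using r0 by (simp flip: powr_mult)
          finally have 1: "3 * \<Theta> * ((r * 2 ^ m j) * (1 / 2 ^ m j) powr t) \<le> 3 * \<Theta> * r powr t"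
            using \<Theta> by (intro mult_left_mono) auto
          have "(1 / 2 ^ m j) powr t \<le> (1::real)"
            using t by (intro powr_le1) auto
          then have "2 ^ m j / 2 ^ a i * (1 / 2 ^ m j) powr t \<le> 2 ^ m j / (2 ^ a i :: real)"
            by (intro mult_left_le) auto
          also have "\<dots> \<le> (2 ^ e i / 2 ^ m i) powr t" using fine[OF j(2)] j(1) by simp
          also have "\<dots> \<le> r powr t" using False t by (intro powr_mono2) auto
          finally show "(3 * \<Theta> * (r * 2 ^ m j) + 2 ^ m j / 2 ^ a i) * (1 / 2 ^ m j) powr t \<le> 3 * \<Theta> * r powr t + r powr t"
            using 1 by (simp add: distrib_right mult.assoc)
        qed (use total_pos[of i] in auto)
        finally show ?thesis by (simp add: R_def distrib_right)
      qed
      then have "total N * real (card (strip i (l - width i) (r + 2 * width i))) \<le>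
          total N * (total i * ((3 * \<Theta> + 1) * r powr t))"
        using total_pos[of N] by (intro mult_left_mono) auto
      with red have "real (card (strip N l r)) * total i \<le> (total N * ((3 * \<Theta> + 1) * r powr t)) * total i"
        by (simp add: mult_ac)
      then have "real (card (strip N l r)) \<le> total N * ((3 * \<Theta> + 1) * r powr t)"
        using total_pos[of i] by simp
      also have "\<dots> \<le> total N * (C * r powr t)"
        using total_pos[of N] by (intro mult_left_mono mult_right_mono) (auto simp: C_def)
      finally show ?thesis by (simp add: mult_ac)
    qed
  qed
  then show ?thesis using C(1) by blast
qed

end

section \<open>Sparse sequences of scales\<close>

text \<open>Factorials have ratios J + j + 2 tending to infinity. Starting late, beyond J > 2 / c,
  makes the first inequality hold for every j and not just eventually.\<close>

lemma exists_sparse_scales: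
  fixes c :: real
  assumes "0 < c"
  shows "\<exists>m :: nat \<Rightarrow> nat. strict_mono m \<and> (\<forall>j. real (m j) + 1 \<le> c * real (m (Suc j))) \<and>
    (\<forall>\<epsilon> C. 0 < \<epsilon> \<longrightarrow> (\<forall>\<^sub>F j in sequentially. C * real (m j) + C \<le> \<epsilon> * real (m (Suc j))))"
proof -
  obtain J :: nat where J: "2 / c < real J" using reals_Archimedean2 by blast
  define m where "m j = (fact (Suc (J + j)) :: nat)" for j
  have m1: "1 \<le> real (m j)" for j
    unfolding m_def by (metis fact_ge_1 of_nat_1 of_nat_le_iff)
  have mS: "real (m (Suc j)) = real (J + j + 2) * real (m j)" for j
    by (simp add: m_def algebra_simps)
  have "strict_mono m"
  proof (rule strict_monoI_Suc)
    fix j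
    have "1 * real (m j) < real (J + j + 2) * real (m j)"
      using m1[of j] by (intro mult_strict_right_mono) auto
    then show "m j < m (Suc j)" unfolding mS[symmetric] by simp
  qed
  moreover have "real (m j) + 1 \<le> c * real (m (Suc j))" for j
  proof -
    have "2 \<le> c * real J" using J assms by (simp add: field_simps)
    also have "\<dots> \<le> c * real (J + j + 2)" using assms by (intro mult_left_mono) auto
    finally have "2 * real (m j) \<le> c * real (J + j + 2) * real (m j)"
      using m1[of j] by (intro mult_right_mono) auto
    then show ?thesis using m1[of j] unfolding mS mult.assoc by linarith
  qed
  moreover have "\<forall>\<^sub>F j in sequentially. C * real (m j) + C \<le> \<epsilon> * real (m (Suc j))" if "0 < \<epsilon>" for \<epsilon> C
  proof -
    obtain n :: nat where n: "2 * \<bar>C\<bar> / \<epsilon> < real n" using reals_Archimedean2 by blast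
    show ?thesis
      unfolding eventually_sequentially
    proof (intro exI[of _ n] allI impI)
      fix j assume "n \<le> j"
      have "2 * \<bar>C\<bar> \<le> \<epsilon> * real n" using n that by (simp add: field_simps)
      also have "\<dots> \<le> \<epsilon> * real (J + j + 2)" using that \<open>n \<le> j\<close> by (intro mult_left_mono) auto
      finally have "2 * \<bar>C\<bar> * real (m j) \<le> \<epsilon> * real (J + j + 2) * real (m j)"
        using m1[of j] by (intro mult_right_mono) auto
      moreover have "C * real (m j) \<le> \<bar>C\<bar> * real (m j)" "\<bar>C\<bar> * 1 \<le> \<bar>C\<bar> * real (m j)"
        using m1[of j] by (intro mult_right_mono mult_left_mono; simp)+
      ultimately show "C * real (m j) + C \<le> \<epsilon> * real (m (Suc j))"
        unfolding mS mult.assoc by linarith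
    qed
  qed
  ultimately show ?thesis by blast
qed

locale sparse_scales =
  fixes m :: "nat \<Rightarrow> nat"
  assumes strict_mono_m: "strict_mono m"
    and sparse: "\<And>\<epsilon> C. 0 < \<epsilon> \<Longrightarrow> \<forall>\<^sub>F j in sequentially. C * real (m j) + C \<le> \<epsilon> * real (m (Suc j))"
begin

lemma le_m: "j \<le> m j"
  using strict_mono_m by (rule strict_mono_imp_increasing)

lemma large_m:
  assumes "0 < \<epsilon>"
  shows "\<forall>\<^sub>F j in sequentially. C \<le> \<epsilon> * real (m j)"
proof -
  obtain n :: nat where n: "C / \<epsilon> < real n" using reals_Archimedean2 by blast
  have "C \<le> \<epsilon> * real (m j)" if "n \<le> j" for j
  proof -
    have "C \<le> \<epsilon> * real n" using n assms by (simp add: field_simps)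
    also have "\<dots> \<le> \<epsilon> * real (m j)"
      using assms that le_m[of j] by (intro mult_left_mono) auto
    finally show ?thesis .
  qed
  then show ?thesis by (auto simp: eventually_sequentially)
qed

lemma scale_tendsto_0: "(\<lambda>j. 1 / 2 ^ m j :: real) \<longlonglongrightarrow> 0"
proof (rule tendsto_sandwich[of "\<lambda>_. 0" _ _ "\<lambda>j. (1 / 2) ^ j"])
  show "\<forall>\<^sub>F j in sequentially. 1 / 2 ^ m j \<le> ((1 / 2) ^ j :: real)"
    using le_m by (auto simp: power_one_over intro!: always_eventually inverse_power_2_mono)
qed (auto intro: LIMSEQ_realpow_zero)

lemma summable_powr_scale:
  assumes "0 < \<delta>" "0 \<le> C" "\<forall>\<^sub>F j in sequentially. 0 \<le> f j \<and> f j \<le> C * 2 powr (- \<delta> * real (m j))"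
  shows "summable f"
proof (rule summable_comparison_test_ev)
  show "\<forall>\<^sub>F j in sequentially. norm (f j) \<le> C * (2 powr (- \<delta>)) ^ j"
    using assms(3)
  proof eventually_elim
    case (elim j)
    have "(2::real) powr (- \<delta> * real (m j)) \<le> 2 powr (- \<delta> * real j)"
      using assms(1) le_m[of j] by (intro powr_mono) auto
    also have "\<dots> = (2 powr (- \<delta>)) ^ j"
      by (simp add: powr_realpow[symmetric] powr_powr)
    finally have "C * 2 powr (- \<delta> * real (m j)) \<le> C * (2 powr (- \<delta>)) ^ j"
      using assms(2) by (rule mult_left_mono)
    with elim show ?case by simp
  qed
  have "(2::real) powr (- \<delta>) < 2 powr 0" using assms(1) by (intro powr_less_mono) auto
  then show "summable (\<lambda>j. C * (2 powr (- \<delta>)) ^ j)"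
    by (intro summable_mult summable_geometric) auto
qed

end

lemma power_2_powr: "(2::real) ^ n = 2 powr real n"
  by (simp add: powr_realpow)

lemma scale_powr: "(1 / 2 ^ n :: real) powr t = 2 powr (- t * real n)"
proof -
  have "(1 / 2 ^ n :: real) = 2 powr (- real n)"
    by (simp add: powr_minus powr_realpow divide_simps)
  then show ?thesis by (simp add: powr_powr mult.commute)
qed

locale sparse_gap_scales = sparse_scales m + gap_scales m a for m a
begin

lemma card_gap_points_interval_le:
  assumes "0 \<le> r"
  shows "real (card {x \<in> gap_points m a j. l \<le> x \<and> x \<le> l + r}) \<le> r * 2 ^ a j + 1"
proof -
  let ?S = "{k::nat. l * 2 ^ a j \<le> real k \<and> real k \<le> l * 2 ^ a j + r * 2 ^ a j}"
  have S: "finite ?S" "real (card ?S) \<le> r * 2 ^ a j + 1"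
    using assms by (intro card_nat_interval_le; simp)+
  have "{x \<in> gap_points m a j. l \<le> x \<and> x \<le> l + r} \<subseteq> (\<lambda>k. real k / 2 ^ a j) ` ?S"
  proof clarify
    fix x assume x: "x \<in> gap_points m a j" "l \<le> x" "x \<le> l + r"
    obtain k where k: "x = real k / 2 ^ a j" using gap_points_grid[OF x(1)] by blast
    have "l * 2 ^ a j \<le> x * 2 ^ a j" "x * 2 ^ a j \<le> (l + r) * 2 ^ a j"
      using x by (auto intro!: mult_right_mono)
    then have "k \<in> ?S" by (simp add: k distrib_right)
    then show "x \<in> (\<lambda>k. real k / 2 ^ a j) ` ?S" using k by blast
  qed
  then have "card {x \<in> gap_points m a j. l \<le> x \<and> x \<le> l + r} \<le> card ?S"
    using S(1) by (rule surj_card_le[rotated])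
  then show ?thesis using S(2) by linarith
qed

text \<open>The one-dimensional estimate is the strip estimate for \<theta> = 0 with both factors
  equal: the strip is then an interval part times the full second factor, whose cardinality
  cancels.\<close>

lemma card_gap_points_frostman:
  fixes c t :: real
  assumes t: "0 < t" "t < c" "c \<le> 1" and dens: "\<And>j. c * real (m j) - 2 \<le> real (a j)"
  shows "\<exists>C>0. \<forall>\<^sub>F N in sequentially. \<forall>l r. 1 / 2 ^ m N \<le> r \<longrightarrow>
    real (card {x \<in> gap_points m a N. l \<le> x \<and> x \<le> l + r}) \<le> C * real (card (gap_points m a N)) * r powr t"
proof -
  interpret gap_strips m a a 0 ..
  have strip: "strip j l r = {x \<in> gap_points m a j. l \<le> x \<and> x \<le> l + r} \<times> gap_points m a j" for j l r
    by (auto simp: strip_def)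
  have cs: "real (card (strip j l r)) =
      real (card {x \<in> gap_points m a j. l \<le> x \<and> x \<le> l + r}) * real (card (gap_points m a j))" for j l r
    by (simp add: strip card_cartesian_product)
  have "\<forall>\<^sub>F j in sequentially. 5 * real (m j) + 5 \<le> (c - t) * real (m (Suc j))"
    using sparse[of "c - t" 5] t by simp
  then obtain i0 where i0: "\<And>j. i0 \<le> j \<Longrightarrow> 5 * real (m j) + 5 \<le> (c - t) * real (m (Suc j))"
    by (auto simp: eventually_sequentially)
  \<comment> \<open>The 5 is 3 for the bound 8 = 2 ^ 3 on the points in a short interval, plus 2 for
    the rounding permitted in \<open>dens\<close>.\<close>
  have gain: "real (m i) + 5 \<le> (c - t) * real (m (Suc i))" if "i0 \<le> i" for i
    using i0[OF that] by linarith
  have "\<exists>C>0. \<forall>N\<ge>Suc i0. \<forall>l r. 1 / 2 ^ m N \<le> r \<longrightarrow> real (card (strip N l r)) \<le> C * total N * r powr t"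
  proof (rule card_strip_frostman[where e = "\<lambda>_. 0"])
    fix j and l :: real assume "Suc i0 \<le> j"
    then obtain i where i: "j = Suc i" "i0 \<le> i" by (cases j) auto
    have "real (card {x \<in> gap_points m a j. l \<le> x \<and> x \<le> l + 5 / 2 ^ m j}) \<le> 5 / 2 ^ m j * 2 ^ a j + 1"
      by (rule card_gap_points_interval_le) simp
    also have "5 / 2 ^ m j * 2 ^ a j + 1 \<le> 5 / 2 ^ m j * 2 ^ m j + (1::real)"
      by (intro add_right_mono mult_left_mono power_increasing a_le_m) auto
    also have "\<dots> \<le> 8" by simp
    also have "\<dots> = 2 powr 3" by simp
    also have "\<dots> \<le> 2 powr (real (a j) - real (m i) - t * real (m j))"
      using gain[OF i(2)] dens[of j] i(1) by (intro powr_mono) (auto simp: algebra_simps)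
    also have "\<dots> = 2 ^ (a j - m i) * (1 / 2 ^ m j) powr t"
      using m_le_a[of i] i(1) unfolding scale_powr by (simp add: power_2_powr of_nat_diff flip: powr_add)
    also have "\<dots> \<le> real (card (gap_points m a j)) * (1 / 2 ^ m j) powr t"
      using card_gap_points_ge[of i] unfolding i(1)
      by (intro mult_right_mono) (metis of_nat_le_iff of_nat_numeral of_nat_power, simp)
    finally have "real (card {x \<in> gap_points m a j. l \<le> x \<and> x \<le> l + 5 / 2 ^ m j}) * real (card (gap_points m a j))
        \<le> real (card (gap_points m a j)) * (1 / 2 ^ m j) powr t * real (card (gap_points m a j))"
      by (intro mult_right_mono) auto
    then show "real (card (strip j l (5 * (1 + \<bar>0\<bar>) * 2 ^ 0 / 2 ^ m j))) \<le> total j * (1 / 2 ^ m j) powr t"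
      by (simp add: cs total_def mult_ac)
  next
    fix j assume "Suc i0 \<le> j"
    then have "real (m j) - real (a (Suc j)) \<le> - t * real (m (Suc j))"
      using gain[of j] dens[of "Suc j"] by (simp add: algebra_simps)
    then have "2 powr (real (m j) - real (a (Suc j))) \<le> (2::real) powr (- t * real (m (Suc j)))"
      by (intro powr_mono) auto
    then show "2 ^ m j / 2 ^ a (Suc j) \<le> (2 ^ 0 / 2 ^ m (Suc j)) powr t"
      unfolding power_0 scale_powr unfolding powr_diff power_2_powr .
  qed (use t in auto)
  then obtain C where C: "0 < C" "\<And>N l r. Suc i0 \<le> N \<Longrightarrow> 1 / 2 ^ m N \<le> r \<Longrightarrow>
      real (card (strip N l r)) \<le> C * total N * r powr t" by blast
  have "real (card {x \<in> gap_points m a N. l \<le> x \<and> x \<le> l + r}) \<le> C * real (card (gap_points m a N)) * r powr t"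
    if "Suc i0 \<le> N" "1 / 2 ^ m N \<le> r" for N l r
  proof -
    have "real (card {x \<in> gap_points m a N. l \<le> x \<and> x \<le> l + r}) * real (card (gap_points m a N)) \<le>
        C * real (card (gap_points m a N)) * r powr t * real (card (gap_points m a N))"
      using C(2)[OF that, of l] by (simp add: cs total_def mult_ac)
    then show ?thesis using card_gap_points_pos[of N] by (simp add: mult_ac)
  qed
  then show ?thesis
    using C(1) by (auto simp: eventually_sequentially intro!: exI[of _ C] exI[of _ "Suc i0"])
qed

end

section \<open>The set and its exceptional directions\<close>

definition plane_set :: "real set \<Rightarrow> real set \<Rightarrow> (real^2) set" where
  "plane_set A B = {v. v $ 1 \<in> A \<and> v $ 2 \<in> B}"

definition plane_point :: "real \<times> real \<Rightarrow> real^2" where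
  "plane_point z = vector [fst z, snd z]"

lemma plane_point_nth [simp]: "plane_point z $ 1 = fst z" "plane_point z $ 2 = snd z"
  by (simp_all add: plane_point_def)

lemma compact_plane_set:
  assumes "compact A" "compact B"
  shows "compact (plane_set A B)"
proof -
  have "plane_set A B = plane_point ` (A \<times> B)"
  proof (intro set_eqI iffI)
    fix v assume "v \<in> plane_set A B"
    moreover have "v = plane_point (v $ 1, v $ 2)" by (simp add: vec_eq_iff forall_2)
    ultimately show "v \<in> plane_point ` (A \<times> B)"
      by (intro image_eqI[of _ _ "(v $ 1, v $ 2)"]) (auto simp: plane_set_def)
  qed (auto simp: plane_set_def)
  moreover have pp: "plane_point = (\<lambda>z. fst z *\<^sub>R vector [1, 0] + snd z *\<^sub>R vector [0, 1])"
    by (rule ext) (simp add: vec_eq_iff forall_2)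
  have "continuous_on (A \<times> B) plane_point"
    unfolding pp by (intro continuous_intros)
  ultimately show ?thesis
    using assms by (simp add: compact_continuous_image compact_Times)
qed

lemma dist_vec_2_le: "dist v w \<le> \<bar>v $ 1 - w $ 1\<bar> + \<bar>v $ 2 - w $ 2\<bar>" for v w :: "real^2"
  unfolding dist_norm using norm_le_l1_cart[of "v - w"] by (simp add: sum_2)

context gap_strips
begin

abbreviation "gap_plane \<equiv> plane_set (gap_cantor m a) (gap_cantor m b)"

lemma compact_gap_plane: "compact gap_plane"
  by (intro compact_plane_set compact_gap_cantor)

text \<open>Grid points projecting into a set of diameter r lie in a strip of width 2 (1 +
  \<bar>\<theta>\<bar>) r around any one of them, so the strip estimate feeds the mass distribution
  principle.\<close>

lemma hausdorff_dim_proj_ge: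
  fixes t C :: real
  assumes lim: "(\<lambda>j. 1 / 2 ^ m j :: real) \<longlonglongrightarrow> 0" and t: "0 < t" and C: "0 < C"
    and frost: "\<forall>\<^sub>F N in sequentially. \<forall>l r. 1 / 2 ^ m N \<le> r \<longrightarrow> real (card (strip N l r)) \<le> C * total N * r powr t"
  shows "ennreal t \<le> hausdorff_dim (proj_line (slope_line \<theta>) ` gap_plane)"
proof (rule mass_distribution_principle[where P = "\<lambda>N. gap_points m a N \<times> gap_points m b N" and
      h = "\<lambda>z. proj_line (slope_line \<theta>) (plane_point z)" and \<rho> = "\<lambda>j. 1 / 2 ^ m j"
      and C = "C * (2 * (1 + \<bar>\<theta>\<bar>)) powr t"])
  show "compact (proj_line (slope_line \<theta>) ` gap_plane)"
    by (intro compact_continuous_image compact_gap_plane bounded_linear.continuous_on[OF bounded_linear_proj_line]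
        continuous_on_id)
  show "proj_line (slope_line \<theta>) (plane_point z) \<in> proj_line (slope_line \<theta>) ` gap_plane"
    if "z \<in> gap_points m a N \<times> gap_points m b N" for N z
    using that A.gap_points_subset[of N] B.gap_points_subset[of N] by (intro imageI) (auto simp: plane_set_def)
  show "\<forall>\<^sub>F n in sequentially. \<forall>U r. 1 / 2 ^ m n \<le> r \<longrightarrow> 0 < r \<longrightarrow> (\<forall>x\<in>U. \<forall>y\<in>U. dist x y \<le> r) \<longrightarrow>
      real (card {i \<in> gap_points m a n \<times> gap_points m b n. proj_line (slope_line \<theta>) (plane_point i) \<in> U})
      \<le> C * (2 * (1 + \<bar>\<theta>\<bar>)) powr t * real (card (gap_points m a n \<times> gap_points m b n)) * r powr t"
    using frost
  proof (eventually_elim, intro allI impI)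
    fix N and U :: "(real^2) set" and r :: real
    assume frost: "\<forall>l r. 1 / 2 ^ m N \<le> r \<longrightarrow> real (card (strip N l r)) \<le> C * total N * r powr t"
      and r: "1 / 2 ^ m N \<le> r" "0 < r" and U: "\<forall>x\<in>U. \<forall>y\<in>U. dist x y \<le> r"
    let ?h = "\<lambda>z. proj_line (slope_line \<theta>) (plane_point z)"
    let ?S = "{z \<in> gap_points m a N \<times> gap_points m b N. ?h z \<in> U}"
    define R where "R = (1 + \<bar>\<theta>\<bar>) * r"
    have R: "r \<le> R" using r(2) by (simp add: R_def mult_le_cancel_right1)
    show "real (card ?S) \<le> C * (2 * (1 + \<bar>\<theta>\<bar>)) powr t * real (card (gap_points m a N \<times> gap_points m b N)) * r powr t"
    proof (cases "?S = {}")
      case False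
      then obtain w where w: "w \<in> ?S" by blast
      have "?S \<subseteq> strip N (fst w + \<theta> * snd w - R) (2 * R)"
      proof
        fix z assume z: "z \<in> ?S"
        have "\<bar>(fst z + \<theta> * snd z) - (fst w + \<theta> * snd w)\<bar> \<le> (1 + \<bar>\<theta>\<bar>) * dist (?h z) (?h w)"
          using dist_proj_slope_line_ge[of "plane_point z" \<theta> "plane_point w"] by simp
        also have "\<dots> \<le> R"
          unfolding R_def using U z w by (intro mult_left_mono) auto
        finally show "z \<in> strip N (fst w + \<theta> * snd w - R) (2 * R)"
          using z by (auto simp: strip_def abs_le_iff)
      qed
      then have "card ?S \<le> card (strip N (fst w + \<theta> * snd w - R) (2 * R))"
        by (intro card_mono) auto
      also have "real \<dots> \<le> C * total N * (2 * R) powr t"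
        using frost R r by auto
      also have "2 * R = 2 * (1 + \<bar>\<theta>\<bar>) * r" by (simp add: R_def)
      also have "(2 * (1 + \<bar>\<theta>\<bar>) * r) powr t = (2 * (1 + \<bar>\<theta>\<bar>)) powr t * r powr t"
        by (rule powr_mult)
      finally show ?thesis by (simp add: total_def card_cartesian_product mult_ac)
    qed (use C in \<open>simp only: card.empty, simp\<close>)
  qed
qed (use t C lim in auto)

end

section \<open>The exponents of the example and the dimension of the set\<close>

locale sharp_example = sparse_scales m for m +
  fixes s u :: real
  assumes s: "0 < s" "s \<le> 1" and us: "u < s" and su: "s \<le> 2 * u"
    and start: "\<And>j. real (m j) + 1 \<le> (s - u) * real (m (Suc j))"
begin

definition b :: "nat \<Rightarrow> nat" where "b j = nat \<lfloor>(s - u) * real (m j)\<rfloor>"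
definition g :: "nat \<Rightarrow> nat" where "g j = nat \<lfloor>(2 * u - s) * real (m j)\<rfloor>"
text \<open>Defined as a sum instead of by rounding u * m j, so that the ratio of the two grid
  spacings is exactly 2 ^ g j; the two roundings explain the 2 in \<open>a_bounds\<close>.\<close>

definition a :: "nat \<Rightarrow> nat" where "a j = b j + g j"

lemma u: "0 < u" "u < 1"
  using s us su by linarith+

lemma nat_floor_bounds: "0 \<le> x \<Longrightarrow> real (nat \<lfloor>x\<rfloor>) \<le> x" "x - 1 \<le> real (nat \<lfloor>x\<rfloor>)"
  by linarith+

lemma b_bounds: "real (b j) \<le> (s - u) * real (m j)" "(s - u) * real (m j) - 1 \<le> real (b j)"
  unfolding b_def using us by (intro nat_floor_bounds; simp)+

lemma g_bounds: "real (g j) \<le> (2 * u - s) * real (m j)" "(2 * u - s) * real (m j) - 1 \<le> real (g j)"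
  unfolding g_def using su by (intro nat_floor_bounds; simp)+

lemma a_bounds: "real (a j) \<le> u * real (m j)" "u * real (m j) - 2 \<le> real (a j)"
  using b_bounds[of j] g_bounds[of j] by (simp_all add: a_def algebra_simps)

lemma m_le_b: "m j \<le> b (Suc j)"
  using start[of j] b_bounds(2)[of "Suc j"] by linarith

lemma factor_le: "real k \<le> c * real n \<Longrightarrow> c \<le> 1 \<Longrightarrow> k \<le> n"
  using mult_right_mono[of c 1 "real n"] by simp

sublocale A: sparse_gap_scales m a
proof
  show "a j \<le> m j" for j using u by (intro factor_le[OF a_bounds(1)]) auto
  show "m j \<le> a (Suc j)" for j using m_le_b[of j] by (simp add: a_def)
qed

sublocale B: sparse_gap_scales m b
proof
  show "b j \<le> m j" for j using s u by (intro factor_le[OF b_bounds(1)]) auto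
qed (rule m_le_b)

text \<open>The grid has no more points than there are intervals of length 1 / 2 ^ m j in a unit
  interval. This balance is what later makes the windows short enough for the integrality
  argument.\<close>

lemma a_plus_b_le: "a j + b j \<le> m j"
  using a_bounds(1)[of j] b_bounds(1)[of j] s by (intro factor_le[of _ s]) (auto simp: algebra_simps)

abbreviation X :: "(real^2) set" where
  "X \<equiv> plane_set (gap_cantor m a) (gap_cantor m b)"

lemma hausdorff_dim_X_ge: "ennreal s \<le> hausdorff_dim X"
proof (rule dense_le_bounded[of 0])
  show "0 < ennreal s" using s by simp
  fix d :: ennreal assume d: "0 < d" "d < ennreal s"
  then have "d < top" by (meson ennreal_less_top less_trans)
  then obtain t where dt: "d = ennreal t" "0 \<le> t" by (cases d) auto
  with d s have t: "0 < t" "t < s" by (auto simp: ennreal_less_iff)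
  \<comment> \<open>The target t < s is split in proportion to the densities u and s - u, so that
    each factor has a strictly smaller Frostman exponent and the exponents add up to t.\<close>
  define p q where "p = t / s * u" and "q = t / s * (s - u)"
  have ts: "0 < t / s" "t / s < 1" using t s by simp_all
  have p: "0 < p" "p < u" and q: "0 < q" "q < s - u"
    unfolding p_def q_def
    using mult_strict_right_mono[OF ts(2) u(1)] mult_strict_right_mono[OF ts(2), of "s - u"]
      mult_pos_pos[OF ts(1) u(1)] mult_pos_pos[OF ts(1), of "s - u"] us by simp_all
  have "p + q = t / s * s" unfolding p_def q_def distrib_left[symmetric] by simp
  then have pq: "p + q = t" using s by simp
  obtain C where C: "0 < C" "\<forall>\<^sub>F N in sequentially. \<forall>l r. 1 / 2 ^ m N \<le> r \<longrightarrow>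
    real (card {x \<in> gap_points m a N. l \<le> x \<and> x \<le> l + r}) \<le> C * real (card (gap_points m a N)) * r powr p"
    using A.card_gap_points_frostman[OF p] u a_bounds(2) by auto
  obtain D where D: "0 < D" "\<forall>\<^sub>F N in sequentially. \<forall>l r. 1 / 2 ^ m N \<le> r \<longrightarrow>
    real (card {x \<in> gap_points m b N. l \<le> x \<and> x \<le> l + r}) \<le> D * real (card (gap_points m b N)) * r powr q"
  proof -
    have "(s - u) * real (m j) - 2 \<le> real (b j)" for j using b_bounds(2)[of j] by linarith
    then show ?thesis using B.card_gap_points_frostman[OF q] s u that by auto
  qed
  have "ennreal t \<le> hausdorff_dim X"
  proof (rule mass_distribution_principle[where P = "\<lambda>N. gap_points m a N \<times> gap_points m b N" and
      h = plane_point and \<rho> = "\<lambda>j. 1 / 2 ^ m j" and C = "C * D * 2 powr t"])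
    show "compact X" by (intro compact_plane_set compact_gap_cantor)
    show "plane_point z \<in> X" if "z \<in> gap_points m a N \<times> gap_points m b N" for N z
      using that A.gap_points_subset[of N] B.gap_points_subset[of N] by (auto simp: plane_set_def)
    show "\<forall>\<^sub>F n in sequentially. \<forall>U r. 1 / 2 ^ m n \<le> r \<longrightarrow> 0 < r \<longrightarrow> (\<forall>x\<in>U. \<forall>y\<in>U. dist x y \<le> r) \<longrightarrow>
      real (card {i \<in> gap_points m a n \<times> gap_points m b n. plane_point i \<in> U})
      \<le> C * D * 2 powr t * real (card (gap_points m a n \<times> gap_points m b n)) * r powr t"
      using C(2) D(2)
    proof (eventually_elim, intro allI impI)
      fix N and U :: "(real^2) set" and r :: real
      assume C': "\<forall>l r. 1 / 2 ^ m N \<le> r \<longrightarrow>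
          real (card {x \<in> gap_points m a N. l \<le> x \<and> x \<le> l + r}) \<le> C * real (card (gap_points m a N)) * r powr p"
        and D': "\<forall>l r. 1 / 2 ^ m N \<le> r \<longrightarrow>
          real (card {x \<in> gap_points m b N. l \<le> x \<and> x \<le> l + r}) \<le> D * real (card (gap_points m b N)) * r powr q"
        and r: "1 / 2 ^ m N \<le> r" "0 < r" and U: "\<forall>x\<in>U. \<forall>y\<in>U. dist x y \<le> r"
      let ?S = "{z \<in> gap_points m a N \<times> gap_points m b N. plane_point z \<in> U}"
      show "real (card ?S) \<le> C * D * 2 powr t * real (card (gap_points m a N \<times> gap_points m b N)) * r powr t"
      proof (cases "?S = {}")
        case False
        then obtain w where w: "w \<in> ?S" by blast
        let ?A = "{x \<in> gap_points m a N. fst w - r \<le> x \<and> x \<le> (fst w - r) + 2 * r}"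
        let ?B = "{x \<in> gap_points m b N. snd w - r \<le> x \<and> x \<le> (snd w - r) + 2 * r}"
        have "?S \<subseteq> ?A \<times> ?B"
        proof
          fix z assume z: "z \<in> ?S"
          have "dist (plane_point z) (plane_point w) \<le> r" using U z w by auto
          then have "\<bar>fst z - fst w\<bar> \<le> r" "\<bar>snd z - snd w\<bar> \<le> r"
            using component_le_norm_cart[of "plane_point z - plane_point w" 1]
              component_le_norm_cart[of "plane_point z - plane_point w" 2] by (simp_all add: dist_norm)
          then show "z \<in> ?A \<times> ?B" using z by (auto simp: mem_Times_iff abs_le_iff)
        qed
        then have "card ?S \<le> card (?A \<times> ?B)" by (intro card_mono) auto
        also have "real \<dots> = real (card ?A) * real (card ?B)" by (simp add: card_cartesian_product)
        also have "\<dots> \<le> (C * real (card (gap_points m a N)) * (2 * r) powr p) * (D * real (card (gap_points m b N)) * (2 * r) powr q)"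
        proof (intro mult_mono)
          have "1 / 2 ^ m N \<le> 2 * r" using r by linarith
          then show "real (card ?A) \<le> C * real (card (gap_points m a N)) * (2 * r) powr p"
            "real (card ?B) \<le> D * real (card (gap_points m b N)) * (2 * r) powr q"
            using C' D' by blast+
        qed (use C D in auto)
        also have "\<dots> = C * D * real (card (gap_points m a N)) * real (card (gap_points m b N)) * ((2 * r) powr p * (2 * r) powr q)"
          by (simp add: mult_ac)
        also have "(2 * r) powr p * (2 * r) powr q = (2 * r) powr t"
          by (simp only: pq flip: powr_add)
        also have "\<dots> = 2 powr t * r powr t" by (rule powr_mult)
        finally show ?thesis by (simp add: card_cartesian_product mult_ac)
      qed (use C D in \<open>simp only: card.empty, simp\<close>)
    qed
  qed (use t C D scale_tendsto_0 in auto)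
  then show "d \<le> hausdorff_dim X" using dt by simp
qed

end

lemma gap_cantor_cell:
  assumes "x \<in> gap_cantor m a"
  obtains k :: nat where "k \<le> 2 ^ a j" "real k / 2 ^ a j \<le> x" "x \<le> real k / 2 ^ a j + 1 / 2 ^ m j"
proof -
  obtain k :: nat where k: "real k / 2 ^ a j \<le> x" "x \<le> real k / 2 ^ a j + 1 / 2 ^ m j" and "x \<le> 1"
    using assms by (auto simp: gap_cantor_def)
  then have "real k / 2 ^ a j \<le> 1" by linarith
  then have "real k \<le> 2 ^ a j" by (simp add: divide_le_eq)
  then have "k \<le> 2 ^ a j" by (metis of_nat_le_iff of_nat_numeral of_nat_power)
  then show ?thesis using k that by blast
qed

lemma (in sparse_scales) summable_cover:
  fixes k :: "nat \<Rightarrow> nat"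
  assumes "0 < \<delta>" "0 \<le> C" "0 \<le> D" "\<And>j. real (k j) \<le> (t - \<delta>) * real (m j)"
  shows "summable (\<lambda>j. C * 2 ^ k j * (D / 2 ^ m j) powr t)"
proof (rule summable_powr_scale[where \<delta> = \<delta> and C = "C * D powr t"])
  show "\<forall>\<^sub>F j in sequentially. 0 \<le> C * 2 ^ k j * (D / 2 ^ m j) powr t \<and>
      C * 2 ^ k j * (D / 2 ^ m j) powr t \<le> C * D powr t * 2 powr (- \<delta> * real (m j))"
  proof (intro always_eventually allI conjI)
    fix j
    have "(D / 2 ^ m j) powr t = D powr t * (1 / 2 ^ m j) powr t"
      using assms(3) by (simp flip: powr_mult)
    then have "C * 2 ^ k j * (D / 2 ^ m j) powr t = C * D powr t * (2 ^ k j * (1 / 2 ^ m j) powr t)"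
      by simp
    also have "2 ^ k j * (1 / 2 ^ m j :: real) powr t = 2 powr (real (k j) - t * real (m j))"
      unfolding scale_powr by (simp add: power_2_powr powr_diff powr_minus divide_inverse)
    also have "C * D powr t * 2 powr (real (k j) - t * real (m j)) \<le> C * D powr t * 2 powr (- \<delta> * real (m j))"
      using assms(2) assms(4)[of j] by (intro mult_left_mono powr_mono) (auto simp: algebra_simps)
    finally show "C * 2 ^ k j * (D / 2 ^ m j) powr t \<le> C * D powr t * 2 powr (- \<delta> * real (m j))" .
  qed (use assms in auto)
qed (use assms in auto)

context sharp_example
begin

text \<open>The level j squares have side 1 / 2 ^ m j and number at most 4 * 2 ^ (a j + b j), with a
  j + b j \<le> s * m j.\<close>

lemma hausdorff_dim_X_le: "hausdorff_dim X \<le> ennreal s"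
proof (rule hausdorff_dim_le_limit[where T = "s + 1"])
  fix t assume t: "s < t" "t < s + 1"
  define \<U> where "\<U> j = (\<lambda>(k, l). {v :: real^2. real k / 2 ^ a j \<le> v $ 1 \<and> v $ 1 \<le> real k / 2 ^ a j + 1 / 2 ^ m j \<and>
      real l / 2 ^ b j \<le> v $ 2 \<and> v $ 2 \<le> real l / 2 ^ b j + 1 / 2 ^ m j}) ` ({..2 ^ a j :: nat} \<times> {..2 ^ b j :: nat})" for j
  show "hausdorff_measure t X = 0"
  proof (rule hausdorff_measure_limsup_eq_0[where \<U> = \<U> and d = "\<lambda>j. 2 / 2 ^ m j" and N = "\<lambda>j. 4 * 2 ^ (a j + b j)"])
    show "\<forall>\<^sub>F j in sequentially. finite (\<U> j) \<and> real (card (\<U> j)) \<le> 4 * 2 ^ (a j + b j)"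
    proof (intro always_eventually allI conjI)
      fix j
      have "card (\<U> j) \<le> card ({..2 ^ a j :: nat} \<times> {..2 ^ b j :: nat})"
        unfolding \<U>_def by (rule card_image_le) simp
      also have "\<dots> = (2 ^ a j + 1) * (2 ^ b j + 1)"
        by (simp add: card_cartesian_product)
      also have "\<dots> \<le> (2 ^ a j + 2 ^ a j) * (2 ^ b j + 2 ^ b j)"
        by (intro mult_mono add_left_mono) auto
      also have "\<dots> = 4 * 2 ^ (a j + b j)" by (simp add: power_add flip: mult_2)
      finally have "real (card (\<U> j)) \<le> real (4 * 2 ^ (a j + b j))" by (rule of_nat_mono)
      then show "real (card (\<U> j)) \<le> 4 * 2 ^ (a j + b j)" by simp
    qed (simp add: \<U>_def)
    show "dist x y \<le> 2 / 2 ^ m j" if "U \<in> \<U> j" "x \<in> U" "y \<in> U" for j U x y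
    proof -
      have "\<bar>x $ 1 - y $ 1\<bar> \<le> 1 / 2 ^ m j" "\<bar>x $ 2 - y $ 2\<bar> \<le> 1 / 2 ^ m j"
        using that unfolding \<U>_def by auto
      then show ?thesis using dist_vec_2_le[of x y] by simp
    qed
    show "summable (\<lambda>j. 4 * 2 ^ (a j + b j) * (2 / 2 ^ m j) powr t)"
    proof (rule summable_cover[where \<delta> = "t - s"])
      show "real (a j + b j) \<le> (t - (t - s)) * real (m j)" for j
        using a_bounds(1)[of j] b_bounds(1)[of j] by (simp add: algebra_simps)
    qed (use t in auto)
    show "\<exists>\<^sub>F j in sequentially. v \<in> \<Union> (\<U> j)" if v: "v \<in> X" for v
    proof (intro eventually_frequently always_eventually allI)
      fix j
      obtain k where "k \<le> 2 ^ a j" "real k / 2 ^ a j \<le> v $ 1" "v $ 1 \<le> real k / 2 ^ a j + 1 / 2 ^ m j"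
        using v gap_cantor_cell[of "v $ 1" m a j] by (auto simp: plane_set_def)
      moreover obtain l where "l \<le> 2 ^ b j" "real l / 2 ^ b j \<le> v $ 2" "v $ 2 \<le> real l / 2 ^ b j + 1 / 2 ^ m j"
        using v gap_cantor_cell[of "v $ 2" m b j] by (auto simp: plane_set_def)
      ultimately show "v \<in> \<Union> (\<U> j)"
        unfolding \<U>_def by (intro UnionI[OF image_eqI[OF refl, of "(k, l)"]]) auto
    qed simp
  qed (use s t in auto)
qed (use s in auto)

lemma hausdorff_dim_proj_le:
  assumes \<theta>: "\<theta> \<in> gap_cantor m g"
  shows "hausdorff_dim (proj_line (slope_line \<theta>) ` X) \<le> ennreal u"
proof (rule hausdorff_dim_le_limit[where T = "u + 1"])
  fix t assume t: "u < t" "t < u + 1"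
  let ?\<pi> = "\<lambda>v :: real^2. v $ 1 + \<theta> * v $ 2"
  define \<U> where "\<U> j = (\<lambda>k. proj_line (slope_line \<theta>) ` {v. real k / 2 ^ a j \<le> ?\<pi> v \<and> ?\<pi> v \<le> real k / 2 ^ a j + 3 / 2 ^ m j})
      ` {..2 * 2 ^ a j :: nat}" for j
  show "hausdorff_measure t (proj_line (slope_line \<theta>) ` X) = 0"
  proof (rule hausdorff_measure_limsup_eq_0[where \<U> = \<U> and d = "\<lambda>j. 3 / 2 ^ m j" and N = "\<lambda>j. 3 * 2 ^ a j"])
    show "\<forall>\<^sub>F j in sequentially. finite (\<U> j) \<and> real (card (\<U> j)) \<le> 3 * 2 ^ a j"
    proof (intro always_eventually allI conjI)
      fix j
      have "card (\<U> j) \<le> card {..2 * 2 ^ a j :: nat}"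
        unfolding \<U>_def by (rule card_image_le) simp
      also have "\<dots> = 2 * 2 ^ a j + 1" by simp
      also have "\<dots> \<le> 3 * 2 ^ a j" by simp
      finally have "real (card (\<U> j)) \<le> real (3 * 2 ^ a j)" by (rule of_nat_mono)
      then show "real (card (\<U> j)) \<le> 3 * 2 ^ a j" by simp
    qed (simp add: \<U>_def)
    show "dist x y \<le> 3 / 2 ^ m j" if U: "U \<in> \<U> j" and xy: "x \<in> U" "y \<in> U" for j U x y
    proof -
      obtain k :: nat where "U = proj_line (slope_line \<theta>) ` {v. real k / 2 ^ a j \<le> ?\<pi> v \<and> ?\<pi> v \<le> real k / 2 ^ a j + 3 / 2 ^ m j}"
        using U by (auto simp: \<U>_def)
      then obtain v w where v: "x = proj_line (slope_line \<theta>) v" "y = proj_line (slope_line \<theta>) w"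
        and k: "real k / 2 ^ a j \<le> ?\<pi> v" "?\<pi> v \<le> real k / 2 ^ a j + 3 / 2 ^ m j"
          "real k / 2 ^ a j \<le> ?\<pi> w" "?\<pi> w \<le> real k / 2 ^ a j + 3 / 2 ^ m j"
        using xy by auto
      have "dist x y \<le> \<bar>?\<pi> v - ?\<pi> w\<bar>" unfolding v by (rule dist_proj_slope_line_le)
      also have "\<dots> \<le> 3 / 2 ^ m j" using k by linarith
      finally show ?thesis .
    qed
    show "summable (\<lambda>j. 3 * 2 ^ a j * (3 / 2 ^ m j) powr t)"
      using t a_bounds(1) by (intro summable_cover[where \<delta> = "t - u"]) auto
    show "\<exists>\<^sub>F j in sequentially. x \<in> \<Union> (\<U> j)" if x: "x \<in> proj_line (slope_line \<theta>) ` X" for x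
    proof (intro eventually_frequently always_eventually allI)
      fix j
      obtain v where v: "x = proj_line (slope_line \<theta>) v" "v $ 1 \<in> gap_cantor m a" "v $ 2 \<in> gap_cantor m b"
        using x by (auto simp: plane_set_def)
      obtain k where k: "k \<le> 2 ^ a j" "real k / 2 ^ a j \<le> v $ 1" "v $ 1 \<le> real k / 2 ^ a j + 1 / 2 ^ m j"
        using gap_cantor_cell[OF v(2), of j] by blast
      obtain l where l: "l \<le> 2 ^ b j" "real l / 2 ^ b j \<le> v $ 2" "v $ 2 \<le> real l / 2 ^ b j + 1 / 2 ^ m j"
        using gap_cantor_cell[OF v(3), of j] by blast
      obtain h where h: "h \<le> 2 ^ g j" "real h / 2 ^ g j \<le> \<theta>" "\<theta> \<le> real h / 2 ^ g j + 1 / 2 ^ m j"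
        using gap_cantor_cell[OF \<theta>, of j] by blast
      have \<theta>01: "0 \<le> \<theta>" "\<theta> \<le> 1" using \<theta> by (auto simp: gap_cantor_def)
      have "real l \<le> 2 ^ b j" using l(1) by (metis of_nat_le_iff of_nat_numeral of_nat_power)
      then have l1: "real l / 2 ^ b j \<le> 1" by (simp add: divide_le_eq)
      \<comment> \<open>Because a j = b j + g j, the product of h / 2 ^ g j and l / 2 ^ b j has
        denominator 2 ^ a j, so the approximate projection lies on the coarse grid indexed by
        K.\<close>
      define K where "K = k + h * l"
      have "h * l \<le> 2 ^ g j * 2 ^ b j" by (intro mult_le_mono h l)
      then have K: "K \<le> 2 * 2 ^ a j" using k(1) by (simp add: K_def a_def power_add mult.commute)
      have "real K / 2 ^ a j = real k / 2 ^ a j + real h / 2 ^ g j * (real l / 2 ^ b j)"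
        by (simp add: K_def a_def power_add add_divide_distrib mult.commute)
      \<comment> \<open>Rounding x, y and \<theta> in turn gives three non-negative errors, each at
        most 1 / 2 ^ m j; this is the 3 in the covering intervals.\<close>
      then have e: "?\<pi> v - real K / 2 ^ a j = (v $ 1 - real k / 2 ^ a j) + \<theta> * (v $ 2 - real l / 2 ^ b j) +
          (\<theta> - real h / 2 ^ g j) * (real l / 2 ^ b j)"
        by (simp add: algebra_simps)
      have "0 \<le> \<theta> * (v $ 2 - real l / 2 ^ b j)" "\<theta> * (v $ 2 - real l / 2 ^ b j) \<le> 1 * (1 / 2 ^ m j)"
        using \<theta>01 l by (simp, intro mult_mono) auto
      moreover have "0 \<le> (\<theta> - real h / 2 ^ g j) * (real l / 2 ^ b j)"
        "(\<theta> - real h / 2 ^ g j) * (real l / 2 ^ b j) \<le> 1 / 2 ^ m j * 1"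
        using h l1 by (simp, intro mult_mono) auto
      ultimately have "0 \<le> ?\<pi> v - real K / 2 ^ a j" "?\<pi> v - real K / 2 ^ a j \<le> 3 * (1 / 2 ^ m j)"
        unfolding e using k(2,3) by linarith+
      then have "real K / 2 ^ a j \<le> ?\<pi> v" "?\<pi> v \<le> real K / 2 ^ a j + 3 / 2 ^ m j" by simp_all
      then show "x \<in> \<Union> (\<U> j)"
        unfolding \<U>_def v(1) using K by (intro UnionI[OF image_eqI[OF refl, of K]]) auto
    qed simp
  qed (use u t in auto)
qed (use u in auto)

text \<open>The slopes in \<open>gap_cantor m g\<close> are all exceptional, and this set has the
  same structure as the factors of X, now with density 2 u - s. The lower Lipschitz bound for slopes
  transfers its point counts to the Grassmannian.\<close>

lemma hausdorff_dim_exceptional_ge: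
  assumes start': "\<And>j. real (m j) + 1 \<le> (2 * u - s) * real (m (Suc j))"
  shows "ennreal (2 * u - s) \<le> hausdorff_dim {V. hausdorff_dim (proj_line V ` X) \<le> ennreal u}"
proof -
  interpret G: sparse_gap_scales m g
  proof
    show "g j \<le> m j" for j using s us by (intro factor_le[OF g_bounds(1)]) auto
    show "m j \<le> g (Suc j)" for j using start'[of j] g_bounds(2)[of "Suc j"] by linarith
  qed
  have pos: "0 < 2 * u - s"
    using start'[of 0] by (smt (verit) mult_nonpos_nonneg of_nat_0_le_iff)
  have "ennreal (2 * u - s) \<le> hausdorff_dim (slope_line ` gap_cantor m g)"
  proof (rule dense_le_bounded[of 0])
    show "0 < ennreal (2 * u - s)" using pos by simp
    fix d :: ennreal assume d: "0 < d" "d < ennreal (2 * u - s)"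
    then have "d < top" by (meson ennreal_less_top less_trans)
    then obtain t where dt: "d = ennreal t" "0 \<le> t" by (cases d) auto
    with d pos have t: "0 < t" "t < 2 * u - s" by (auto simp: ennreal_less_iff)
    have dens: "(2 * u - s) * real (m j) - 2 \<le> real (g j)" for j using g_bounds(2)[of j] by linarith
    obtain C where C: "0 < C" "\<forall>\<^sub>F N in sequentially. \<forall>l r. 1 / 2 ^ m N \<le> r \<longrightarrow>
      real (card {x \<in> gap_points m g N. l \<le> x \<and> x \<le> l + r}) \<le> C * real (card (gap_points m g N)) * r powr t"
      using G.card_gap_points_frostman[OF t _ dens] s us by auto
    have "ennreal t \<le> hausdorff_dim (slope_line ` gap_cantor m g)"
    proof (rule mass_distribution_principle[where P = "gap_points m g" and h = slope_line and
          \<rho> = "\<lambda>j. 1 / 2 ^ m j" and C = "C * 4 powr t"])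
      show "compact (slope_line ` gap_cantor m g)"
        by (intro compact_continuous_image continuous_on_slope_line compact_gap_cantor)
      show "slope_line x \<in> slope_line ` gap_cantor m g" if "x \<in> gap_points m g N" for N x
        using that G.gap_points_subset[of N] by blast
      show "\<forall>\<^sub>F n in sequentially. \<forall>U r. 1 / 2 ^ m n \<le> r \<longrightarrow> 0 < r \<longrightarrow> (\<forall>x\<in>U. \<forall>y\<in>U. dist x y \<le> r) \<longrightarrow>
        real (card {i \<in> gap_points m g n. slope_line i \<in> U}) \<le> C * 4 powr t * real (card (gap_points m g n)) * r powr t"
        using C(2)
      proof (eventually_elim, intro allI impI)
        fix N and U :: "G21 set" and r :: real
        assume C': "\<forall>l r. 1 / 2 ^ m N \<le> r \<longrightarrow>
            real (card {x \<in> gap_points m g N. l \<le> x \<and> x \<le> l + r}) \<le> C * real (card (gap_points m g N)) * r powr t"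
          and r: "1 / 2 ^ m N \<le> r" "0 < r" and U: "\<forall>x\<in>U. \<forall>y\<in>U. dist x y \<le> r"
        let ?S = "{x \<in> gap_points m g N. slope_line x \<in> U}"
        show "real (card ?S) \<le> C * 4 powr t * real (card (gap_points m g N)) * r powr t"
        proof (cases "?S = {}")
          case False
          then obtain w where w: "w \<in> ?S" by blast
          have "?S \<subseteq> {x \<in> gap_points m g N. w - 2 * r \<le> x \<and> x \<le> (w - 2 * r) + 4 * r}"
          proof
            fix z assume z: "z \<in> ?S"
            have "\<bar>z - w\<bar> \<le> 2 * dist (slope_line z) (slope_line w)"
              using G.gap_points_bounds z w by (intro dist_slope_line_ge) auto
            also have "\<dots> \<le> 2 * r" using U z w by auto
            finally show "z \<in> {x \<in> gap_points m g N. w - 2 * r \<le> x \<and> x \<le> (w - 2 * r) + 4 * r}"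
              using z by (auto simp: abs_le_iff)
          qed
          then have "card ?S \<le> card {x \<in> gap_points m g N. w - 2 * r \<le> x \<and> x \<le> (w - 2 * r) + 4 * r}"
            by (intro card_mono) auto
          also have "real \<dots> \<le> C * real (card (gap_points m g N)) * (4 * r) powr t"
          proof -
            have "1 / 2 ^ m N \<le> 4 * r" using r by linarith
            then show ?thesis using C' by blast
          qed
          also have "(4 * r) powr t = 4 powr t * r powr t" by (rule powr_mult)
          finally show ?thesis by (simp add: mult_ac)
        qed (use C in \<open>simp only: card.empty, simp\<close>)
      qed
    qed (use t C scale_tendsto_0 in auto)
    then show "d \<le> hausdorff_dim (slope_line ` gap_cantor m g)" using dt by simp
  qed
  also have "\<dots> \<le> hausdorff_dim {V. hausdorff_dim (proj_line V ` X) \<le> ennreal u}"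
    using hausdorff_dim_proj_le by (intro hausdorff_dim_mono) auto
  finally show ?thesis .
qed

end

section \<open>Slopes far from fractions, and the upper bound for the exceptional set\<close>

context sharp_example
begin

text \<open>Far from fractions, a thin strip contains about 2 ^ (b j - e j) points instead of up to
  2 ^ b j. This gain of e j, about \<kappa> * m j, in the exponent lifts the dimension strictly
  above u.\<close>

lemma hausdorff_dim_proj_ge_of_far:
  fixes \<theta> \<kappa> :: real
  defines "e \<equiv> \<lambda>j. nat \<lfloor>\<kappa> * real (m j)\<rfloor>"
  assumes \<kappa>: "0 < \<kappa>" "\<kappa> \<le> 1 - u" "6 * \<kappa> \<le> s - u"
    and far: "\<forall>\<^sub>F j in sequentially. \<forall>(q::nat) (p::int). 1 \<le> q \<longrightarrow> q \<le> (2::nat) ^ e j \<longrightarrow>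
      2 ^ (5 * e j) / 2 ^ m j < \<bar>\<theta> + p / (q * 2 ^ g j)\<bar>"
  shows "ennreal (u + \<kappa> * u / 2) \<le> hausdorff_dim (proj_line (slope_line \<theta>) ` X)"
proof -
  interpret gap_strips m a b \<theta> ..
  \<comment> \<open>The fineness condition compares 2 ^ (- a), with a about u m, to 2 ^ (- t (1 -
    \<kappa>) m), which permits a gain of about \<kappa> u. Half of it is given up to absorb the
    previous scale and rounding.\<close>
  define t where "t = u + \<kappa> * u / 2"
  define \<Theta> where "\<Theta> = 1 + \<bar>\<theta>\<bar>"
  have \<Theta>: "1 \<le> \<Theta>" by (simp add: \<Theta>_def)
  have "\<kappa> * u \<le> (1 - u) * 1" using \<kappa> u by (intro mult_mono) auto
  then have t: "u \<le> t" "t \<le> 1" using \<kappa> u by (simp_all add: t_def)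
  have e_bounds: "real (e j) \<le> \<kappa> * real (m j)" "\<kappa> * real (m j) - 1 \<le> real (e j)" for j
    unfolding e_def using \<kappa> by (intro nat_floor_bounds; simp)+
  obtain n :: nat where n: "10 * \<Theta> < 2 ^ n" using real_arch_pow[of 2 "10 * \<Theta>"] by auto
  have "\<forall>\<^sub>F j in sequentially. (6 * real (m j) + 6 \<le> \<kappa> * u / 2 * real (m (Suc j)) \<and> real n + 1 \<le> \<kappa> * real (m j)) \<and>
      1 \<le> (s - u) / 2 * real (m j) \<and> (\<forall>(q::nat) (p::int). 1 \<le> q \<longrightarrow> q \<le> (2::nat) ^ e j \<longrightarrow>
        2 ^ (5 * e j) / 2 ^ m j < \<bar>\<theta> + p / (q * 2 ^ g j)\<bar>)"
    using \<kappa> u us by (intro eventually_conj sparse large_m far) auto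
  then obtain j0 where j0:
      "\<And>j. j0 \<le> j \<Longrightarrow> 6 * real (m j) + 6 \<le> \<kappa> * u / 2 * real (m (Suc j))"
      "\<And>j. j0 \<le> j \<Longrightarrow> real n + 1 \<le> \<kappa> * real (m j)"
      "\<And>j. j0 \<le> j \<Longrightarrow> 1 \<le> (s - u) / 2 * real (m j)"
      "\<And>j (q::nat) (p::int). j0 \<le> j \<Longrightarrow> 1 \<le> q \<Longrightarrow> q \<le> (2::nat) ^ e j \<Longrightarrow>
        2 ^ (5 * e j) / 2 ^ m j < \<bar>\<theta> + p / (q * 2 ^ g j)\<bar>"
    unfolding eventually_sequentially by blast
  have "\<exists>C>0. \<forall>N\<ge>Suc j0. \<forall>l r. 1 / 2 ^ m N \<le> r \<longrightarrow> real (card (strip N l r)) \<le> C * total N * r powr t"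
  proof (rule card_strip_frostman[where e = e])
    fix j and l :: real assume "Suc j0 \<le> j"
    then obtain i where i: "j = Suc i" "j0 \<le> i" by (cases j) auto
    have jj: "j0 \<le> j" using i by simp
    have "real n \<le> real (e j)" using j0(2)[OF jj] e_bounds(2)[of j] by linarith
    then have "(2::real) ^ n \<le> 2 ^ e j" by simp
    then have e\<Theta>: "10 * \<Theta> < 2 ^ e j" using n by linarith
    \<comment> \<open>The aim is 3 e \<le> b, so that a window of length 2 ^ (b - 2 e) has at least
      2 ^ e elements and the extra 1 per window does not dominate. The 6 in the hypothesis on
      \<kappa> leaves half of (s - u) * m j for rounding.\<close>
    have "3 * (\<kappa> * real (m j)) \<le> (s - u) / 2 * real (m j)"
      using mult_right_mono[OF \<kappa>(3), of "real (m j)"] by simp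
    then have "3 * real (e j) \<le> real (b j)"
      using e_bounds(1)[of j] b_bounds(2)[of j] j0(3)[OF jj] by (simp add: field_simps)
    then have eb: "3 * e j \<le> b j" by linarith
    \<comment> \<open>With strip width 5 \<Theta> P / M and 2 ^ a * 2 ^ b \<le> M, one factor P
      removed from the window cancels the strip width and the second one beats the constant 10
      \<Theta>.\<close>
    define w where "w = b j - 2 * e j"
    define P :: real where "P = 2 ^ e j"
    define M :: real where "M = 2 ^ m j"
    define W :: real where "W = 2 ^ w"
    define G :: real where "G = 2 ^ g j"
    have pos: "1 \<le> P" "0 < M" "0 < W" "0 < G" by (simp_all add: P_def M_def W_def G_def)
    have bj: "2 ^ b j = W * P ^ 2"
      using eb by (simp add: w_def W_def P_def mult.commute flip: power_mult power_add)
    have aj: "2 ^ a j = W * P ^ 2 * G" by (simp add: a_def power_add bj G_def)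
    have "(2::real) ^ (a j + b j) \<le> M"
      unfolding M_def by (intro power_increasing a_plus_b_le) simp
    then have ab: "2 ^ a j * 2 ^ b j \<le> M" by (simp add: power_add)
    define R where "R = 5 * \<Theta> * P / M"
    have Rpos: "0 < R" using pos \<Theta> by (simp add: R_def)
    have "real (card (strip j l R)) \<le> 2 ^ (b j - w) * (2 ^ w / real (2 ^ e j) + 1)"
    proof (rule card_strip_far_le[where g = "g j"])
      have "2 * (R * 2 ^ a j) * W * P = 10 * \<Theta> * (2 ^ a j * 2 ^ b j) / M"
        by (simp add: R_def bj power2_eq_square)
      also have "\<dots> \<le> 10 * \<Theta> * M / M"
        using \<Theta> ab pos by (intro divide_right_mono mult_left_mono) auto
      also have "\<dots> < 1 * P" using pos e\<Theta> by (simp add: P_def)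
      finally show "2 * (R * 2 ^ a j) * 2 ^ w < 1"
        unfolding W_def[symmetric] using pos by (simp only: mult_less_cancel_right_pos)
    next
      fix q :: nat and p :: int
      assume q: "1 \<le> q" "q \<le> (2::nat) ^ e j"
      \<comment> \<open>Origin of the exponent 5 e: one P from the strip width, two from the
        shortened window, one from the bound on q, and a fifth that absorbs 5 \<Theta>.\<close>
      have "R * 2 ^ a j * real (2 ^ e j) / 2 ^ w = 5 * \<Theta> * P ^ 4 * G / M"
        using pos by (simp add: R_def aj W_def[symmetric] P_def[symmetric] power2_eq_square power4_eq_xxxx)
      also have "\<dots> \<le> P * P ^ 4 * G / M"
        using e\<Theta> pos \<Theta> by (intro divide_right_mono mult_right_mono) (auto simp: P_def)
      also have "\<dots> = (2 ^ (5 * e j) / 2 ^ m j) * G"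
        by (simp add: P_def M_def power4_eq_xxxx flip: power_add)
      also have "\<dots> < \<bar>\<theta> + p / (q * 2 ^ g j)\<bar> * G"
        using j0(4)[OF jj q] pos by (intro mult_strict_right_mono)
      also have "\<dots> = \<bar>(\<theta> + p / (q * G)) * G\<bar>" using pos by (simp add: abs_mult G_def)
      also have "(\<theta> + p / (q * G)) * G = \<theta> * 2 ^ g j + p / q"
        using pos by (simp add: G_def[symmetric] distrib_right)
      finally show "R * 2 ^ a j * real (2 ^ e j) / 2 ^ w < \<bar>\<theta> * 2 ^ g j + p / q\<bar>" .
    qed (use Rpos in \<open>auto simp: a_def w_def\<close>)
    also have "\<dots> = P ^ 2 * (W / P + 1)"
      using eb by (simp add: w_def W_def P_def mult.commute flip: power_mult)
    also have "\<dots> \<le> 2 * (2 ^ b j / P)"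
    proof -
      have "P ^ 3 \<le> 2 ^ b j"
        using eb by (simp add: P_def mult.commute flip: power_mult)
      then have P2: "P ^ 2 \<le> 2 ^ b j / P"
        using pos by (simp add: pos_le_divide_eq power3_eq_cube power2_eq_square)
      have "P ^ 2 * (W / P) = 2 ^ b j / P" by (simp add: bj)
      from add_mono[OF eq_refl[OF this] P2] show ?thesis
        by (simp only: distrib_left mult_1_right mult_2)
    qed
    also have "\<dots> = 2 powr (1 + real (b j) - real (e j))"
      by (simp add: P_def power_2_powr powr_diff powr_add)
    also have "\<dots> \<le> 2 powr (real (a j) - real (m i) + (real (b j) - real (m i)) - t * real (m j))"
    proof (intro powr_mono)
      have "u * (\<kappa> * real (m j)) \<le> 1 * (\<kappa> * real (m j))"
        using u \<kappa> by (intro mult_right_mono) auto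
      moreover have "6 * real (m i) + 6 \<le> \<kappa> * u / 2 * real (m j)" using j0(1)[OF i(2)] i(1) by simp
      moreover have "t * real (m j) = u * real (m j) + \<kappa> * u / 2 * real (m j)"
        by (simp add: t_def distrib_right)
      moreover have "\<kappa> * u / 2 * real (m j) = u * (\<kappa> * real (m j)) / 2" by simp
      ultimately show "1 + real (b j) - real (e j) \<le> real (a j) - real (m i) + (real (b j) - real (m i)) - t * real (m j)"
        using a_bounds(2)[of j] e_bounds(2)[of j] by linarith
    qed simp
    also have "\<dots> = 2 ^ (a j - m i) * 2 ^ (b j - m i) * (1 / 2 ^ m j) powr t"
      using A.m_le_a[of i] B.m_le_a[of i] i(1) unfolding scale_powr
      by (simp add: power_2_powr of_nat_diff flip: powr_add)
    also have "\<dots> \<le> total j * (1 / 2 ^ m j) powr t"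
    proof (rule mult_right_mono)
      have "2 ^ (a j - m i) \<le> real (card (gap_points m a j))" "2 ^ (b j - m i) \<le> real (card (gap_points m b j))"
        using A.card_gap_points_ge[of i] B.card_gap_points_ge[of i] unfolding i(1)
        by (metis of_nat_le_iff of_nat_numeral of_nat_power)+
      then show "2 ^ (a j - m i) * 2 ^ (b j - m i) \<le> total j"
        unfolding total_def of_nat_mult by (intro mult_mono) auto
    qed simp
    finally show "real (card (strip j l (5 * (1 + \<bar>\<theta>\<bar>) * 2 ^ e j / 2 ^ m j))) \<le> total j * (1 / 2 ^ m j) powr t"
      by (simp only: R_def P_def M_def \<Theta>_def)
  next
    fix j assume j: "Suc j0 \<le> j"
    define M where "M = real (m (Suc j))"
    have "real (m j) - real (a (Suc j)) \<le> t * (real (e (Suc j)) - real (m (Suc j)))"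
    proof -
      have "6 * real (m j) + 6 \<le> \<kappa> * u / 2 * M" using j0(1)[of j] j by (simp add: M_def)
      moreover have "t * (\<kappa> * M - 1) \<le> t * real (e (Suc j))"
        using t u e_bounds(2)[of "Suc j"] by (intro mult_left_mono) (auto simp: M_def)
      moreover have "t * (\<kappa> * M - 1) = t * (\<kappa> * M) - t" by (simp add: right_diff_distrib)
      moreover have "u * (\<kappa> * M) \<le> t * (\<kappa> * M)"
        using t \<kappa> by (intro mult_right_mono) (auto simp: M_def)
      moreover have "t * M = u * M + \<kappa> * u / 2 * M" by (simp add: t_def distrib_right)
      moreover have "\<kappa> * u / 2 * M = u * (\<kappa> * M) / 2" by simp
      moreover have "u * M - 2 \<le> real (a (Suc j))" using a_bounds(2)[of "Suc j"] by (simp add: M_def)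
      moreover have "t * (real (e (Suc j)) - M) = t * real (e (Suc j)) - t * M" by (rule right_diff_distrib)
      ultimately show ?thesis unfolding M_def[symmetric] using t by linarith
    qed
    then have "(2::real) powr (real (m j) - real (a (Suc j))) \<le> 2 powr (t * (real (e (Suc j)) - real (m (Suc j))))"
      by (intro powr_mono) auto
    also have "\<dots> = (2 powr (real (e (Suc j)) - real (m (Suc j)))) powr t"
      by (simp add: powr_powr mult.commute)
    finally show "2 ^ m j / 2 ^ a (Suc j) \<le> (2 ^ e (Suc j) / 2 ^ m (Suc j)) powr t"
      unfolding powr_diff power_2_powr .
  qed (use t u in auto)
  then obtain C where C: "0 < C" "\<forall>N\<ge>Suc j0. \<forall>l r. 1 / 2 ^ m N \<le> r \<longrightarrow>
      real (card (strip N l r)) \<le> C * total N * r powr t" by blast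
  have "ennreal t \<le> hausdorff_dim (proj_line (slope_line \<theta>) ` X)"
  proof (rule hausdorff_dim_proj_ge[OF scale_tendsto_0 _ C(1)])
    show "\<forall>\<^sub>F N in sequentially. \<forall>l r. 1 / 2 ^ m N \<le> r \<longrightarrow> real (card (strip N l r)) \<le> C * total N * r powr t"
      using C(2) by (auto simp: eventually_sequentially)
  qed (use t u in linarith)
  then show ?thesis by (simp add: t_def)
qed

lemma hausdorff_measure_exceptional_eq_0:
  assumes t: "2 * u - s < t" "t < 1"
  shows "hausdorff_measure t {V. hausdorff_dim (proj_line V ` X) \<le> ennreal u} = 0"
proof -
  \<comment> \<open>The first two entries serve the lower bound for projections. In the covering sum
    the powers of 2 ^ e amount to at most 3 e + 5 e t \<le> 8 e, so 16 uses up half of the surplus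
    of t over 2 u - s. The entry 1 / 5 keeps the radius 2 ^ (5 e) / 2 ^ m at most 1.\<close>
  define \<kappa> where "\<kappa> = Min {1 - u, (s - u) / 6, (t - (2 * u - s)) / 16, 1 / 5}"
  have \<kappa>: "0 < \<kappa>" "\<kappa> \<le> 1 - u" "6 * \<kappa> \<le> s - u" "16 * \<kappa> \<le> t - (2 * u - s)" "5 * \<kappa> \<le> 1"
    unfolding \<kappa>_def using u us t by (auto simp: min_def)
  define e where "e j = nat \<lfloor>\<kappa> * real (m j)\<rfloor>" for j
  have e_bounds: "real (e j) \<le> \<kappa> * real (m j)" "\<kappa> * real (m j) - 1 \<le> real (e j)" for j
    unfolding e_def using \<kappa> by (intro nat_floor_bounds; simp)+
  have t0: "0 < t" using t su by linarith
  \<comment> \<open>Slopes are unbounded, so numerators are bounded by a growing range: eventually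
    \<bar>\<theta>\<bar> + 1 < 2 ^ e, and then \<bar>p\<bar> \<le> 2 ^ e * q * 2 ^ g with q \<le> 2
    ^ e.\<close>
  define P where "P j = (2::int) ^ (2 * e j + g j)" for j
  define Q where "Q j = {1..2 ^ e j :: nat} \<times> {- P j..P j}" for j
  \<comment> \<open>The vertical line has no slope and is added to every family as a singleton,
    which costs one more set of diameter 0.\<close>
  define \<U> where "\<U> j = insert {vertical_line}
      ((\<lambda>(q, p). slope_line ` {\<theta>. \<bar>\<theta> + p / (q * 2 ^ g j)\<bar> \<le> 2 ^ (5 * e j) / 2 ^ m j}) ` Q j)" for j
  define d where "d j = (8 * (2 ^ (5 * e j) / 2 ^ m j) :: real)" for j
  define N where "N j = (4 * 2 ^ (3 * e j + g j) :: real)" for j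
  show ?thesis
  proof (rule hausdorff_measure_limsup_eq_0[where \<U> = \<U> and d = d and N = N])
    show "\<forall>\<^sub>F j in sequentially. finite (\<U> j) \<and> real (card (\<U> j)) \<le> N j"
    proof (intro always_eventually allI conjI)
      fix j
      have finQ: "finite (Q j)" by (simp add: Q_def)
      then show "finite (\<U> j)" by (simp add: \<U>_def)
      have "card (\<U> j) \<le> Suc (card (Q j))"
        unfolding \<U>_def by (intro card_insert_le_m1) (simp_all add: card_image_le finQ)
      also have "card (Q j) = 2 ^ e j * nat (2 * P j + 1)"
        by (simp add: Q_def card_cartesian_product)
      also have "nat (2 * P j + 1) = 2 * 2 ^ (2 * e j + g j) + 1"
        by (simp add: P_def nat_add_distrib nat_mult_distrib nat_power_eq)
      also have "Suc (2 ^ e j * (2 * 2 ^ (2 * e j + g j) + 1)) \<le> 4 * (2 ^ e j * 2 ^ (2 * e j + g j))"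
      proof -
        have "2 ^ e j * 1 \<le> (2 ^ e j * 2 ^ (2 * e j + g j) :: nat)" by (intro mult_le_mono2) simp
        moreover have "1 \<le> (2 ^ e j :: nat)" by simp
        moreover have "2 ^ e j * (2 * 2 ^ (2 * e j + g j) + 1) = 2 * (2 ^ e j * 2 ^ (2 * e j + g j)) + (2 ^ e j :: nat)"
          by (simp add: algebra_simps)
        ultimately show ?thesis by linarith
      qed
      also have "4 * (2 ^ e j * 2 ^ (2 * e j + g j)) = (4 * 2 ^ (3 * e j + g j) :: nat)"
        by (simp flip: power_add)
      finally have "real (card (\<U> j)) \<le> real (4 * 2 ^ (3 * e j + g j))" by (rule of_nat_mono)
      then show "real (card (\<U> j)) \<le> N j" by (simp add: N_def)
    qed
    show "dist x y \<le> d j" if U: "U \<in> \<U> j" and xy: "x \<in> U" "y \<in> U" for j U x y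
    proof (cases "U = {vertical_line}")
      case True
      then show ?thesis using xy by (simp add: d_def)
    next
      case False
      then obtain c where "U = slope_line ` {\<theta>. \<bar>\<theta> + c\<bar> \<le> 2 ^ (5 * e j) / 2 ^ m j}"
        using U by (auto simp: \<U>_def)
      then obtain \<theta> \<theta>' where \<theta>: "x = slope_line \<theta>" "y = slope_line \<theta>'"
        "\<bar>\<theta> + c\<bar> \<le> 2 ^ (5 * e j) / 2 ^ m j" "\<bar>\<theta>' + c\<bar> \<le> 2 ^ (5 * e j) / 2 ^ m j"
        using xy by auto
      have "dist x y \<le> 4 * \<bar>\<theta> - \<theta>'\<bar>" unfolding \<theta>(1,2) by (rule dist_slope_line_le)
      also have "\<dots> \<le> d j"
      proof -
        have "4 * \<bar>\<theta> - \<theta>'\<bar> \<le> 8 * r" if "\<bar>\<theta> + c\<bar> \<le> r" "\<bar>\<theta>' + c\<bar> \<le> r" for r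
          using abs_triangle_ineq4[of "\<theta> + c" "\<theta>' + c"] that by simp
        from this[OF \<theta>(3,4)] show ?thesis by (simp only: d_def)
      qed
      finally show ?thesis .
    qed
    show "summable (\<lambda>j. N j * d j powr t)"
    proof (rule summable_powr_scale[where \<delta> = "(t - (2 * u - s)) / 2" and C = 32])
      show "\<forall>\<^sub>F j in sequentially. 0 \<le> N j * d j powr t \<and>
          N j * d j powr t \<le> 32 * 2 powr (- ((t - (2 * u - s)) / 2) * real (m j))"
      proof (intro always_eventually allI conjI)
        fix j
        have "d j powr t = 8 powr t * (2 ^ (5 * e j) / 2 ^ m j) powr t"
          unfolding d_def by (rule powr_mult)
        also have "(2 ^ (5 * e j) / 2 ^ m j :: real) = 2 powr (5 * real (e j) - real (m j))"
          by (simp add: power_2_powr powr_diff)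
        also have "8 powr t * (2 powr (5 * real (e j) - real (m j))) powr t \<le>
            8 * 2 powr ((5 * real (e j) - real (m j)) * t)"
          using powr_mono[of t 1 "8::real"] t by (simp add: powr_powr)
        finally have "N j * d j powr t \<le> N j * (8 * 2 powr ((5 * real (e j) - real (m j)) * t))"
          by (intro mult_left_mono) (auto simp: N_def)
        also have "\<dots> = 32 * 2 powr (3 * real (e j) + real (g j) + (5 * real (e j) - real (m j)) * t)"
          by (simp add: N_def power_2_powr powr_add)
        also have "\<dots> \<le> 32 * 2 powr (- ((t - (2 * u - s)) / 2) * real (m j))"
        proof (intro mult_left_mono powr_mono)
          have "real (e j) * t \<le> real (e j) * 1" using t by (intro mult_left_mono) auto
          moreover have "16 * (\<kappa> * real (m j)) \<le> (t - (2 * u - s)) * real (m j)"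
            using mult_right_mono[OF \<kappa>(4), of "real (m j)"] by simp
          ultimately show "3 * real (e j) + real (g j) + (5 * real (e j) - real (m j)) * t
              \<le> - ((t - (2 * u - s)) / 2) * real (m j)"
            using e_bounds(1)[of j] g_bounds(1)[of j] by (simp add: algebra_simps) (simp add: field_simps)
        qed auto
        finally show "N j * d j powr t \<le> 32 * 2 powr (- ((t - (2 * u - s)) / 2) * real (m j))" .
      qed (auto simp: N_def)
    qed (use t in auto)
    show "\<exists>\<^sub>F j in sequentially. V \<in> \<Union> (\<U> j)"
      if V: "V \<in> {V. hausdorff_dim (proj_line V ` X) \<le> ennreal u}" for V
    proof (cases "V = vertical_line")
      case True
      then show ?thesis
        by (intro eventually_frequently always_eventually allI) (auto simp: \<U>_def)
    next
      case False
      then obtain \<theta> where \<theta>: "V = slope_line \<theta>" using G21_cases by blast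
      obtain n :: nat where n: "\<bar>\<theta>\<bar> + 1 < 2 ^ n" using real_arch_pow[of 2 "\<bar>\<theta>\<bar> + 1"] by auto
      show ?thesis
      \<comment> \<open>A direction lying in only finitely many families is eventually far from all
        admissible fractions, so its projection has dimension at least u + \<kappa> u / 2 and the
        direction cannot be exceptional.\<close>
      proof (rule ccontr)
        assume "\<not> (\<exists>\<^sub>F j in sequentially. V \<in> \<Union> (\<U> j))"
        then have "\<forall>\<^sub>F j in sequentially. V \<notin> \<Union> (\<U> j)" by (simp add: not_frequently)
        moreover have "\<forall>\<^sub>F j in sequentially. real n + 1 \<le> \<kappa> * real (m j)" using \<kappa>(1) by (rule large_m)
        ultimately have "\<forall>\<^sub>F j in sequentially. \<forall>(q::nat) (p::int). 1 \<le> q \<longrightarrow> q \<le> (2::nat) ^ e j \<longrightarrow>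
            2 ^ (5 * e j) / 2 ^ m j < \<bar>\<theta> + p / (q * 2 ^ g j)\<bar>"
        proof eventually_elim
          case (elim j)
          note nV = elim(1) and nj = elim(2)
          show ?case
          proof (intro allI impI, rule ccontr)
            fix q :: nat and p :: int
            assume q: "1 \<le> q" "q \<le> (2::nat) ^ e j"
              and "\<not> 2 ^ (5 * e j) / 2 ^ m j < \<bar>\<theta> + p / (q * 2 ^ g j)\<bar>"
            then have close: "\<bar>\<theta> + p / (q * 2 ^ g j)\<bar> \<le> 2 ^ (5 * e j) / 2 ^ m j" by simp
            have "5 * real (e j) \<le> real (m j)"
              using e_bounds(1)[of j] mult_right_mono[OF \<kappa>(5), of "real (m j)"] by simp
            then have "5 * e j \<le> m j" by linarith
            then have "(2::real) ^ (5 * e j) \<le> 2 ^ m j" by (intro power_increasing) auto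
            then have "2 ^ (5 * e j) / 2 ^ m j \<le> (1::real)" by (simp add: divide_le_eq)
            moreover have "real n \<le> real (e j)" using nj e_bounds(2)[of j] by linarith
            then have "(2::real) ^ n \<le> 2 ^ e j" by simp
            ultimately have "\<bar>p / (q * 2 ^ g j)\<bar> \<le> 2 ^ e j" using close n by linarith
            then have "\<bar>real_of_int p\<bar> \<le> 2 ^ e j * (real q * 2 ^ g j)"
              using q by (simp add: abs_mult divide_le_eq)
            also have "\<dots> \<le> 2 ^ e j * (2 ^ e j * 2 ^ g j)"
            proof -
              have "real q \<le> 2 ^ e j" using q(2) by (metis of_nat_le_iff of_nat_numeral of_nat_power)
              then show ?thesis by (intro mult_left_mono mult_right_mono) auto
            qed
            also have "\<dots> = real_of_int (P j)" by (simp add: P_def power_add mult_2)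
            finally have "\<bar>p\<bar> \<le> P j" by (simp only: of_int_le_iff flip: of_int_abs)
            then have "(q, p) \<in> Q j" using q by (auto simp: Q_def)
            then have "V \<in> \<Union> (\<U> j)"
              unfolding \<U>_def \<theta> using close by (intro UnionI[OF insertI2[OF imageI]]) auto
            with nV show False by blast
          qed
        qed
        from hausdorff_dim_proj_ge_of_far[OF \<kappa>(1,2,3) this[unfolded e_def]]
        have "ennreal (u + \<kappa> * u / 2) \<le> ennreal u"
          using V \<theta> by (auto intro: order_trans)
        then show False using u \<kappa> by (simp add: ennreal_le_iff)
      qed
    qed
  qed (use t0 in \<open>auto simp: d_def\<close>)
qed

lemma hausdorff_dim_exceptional_le:
  "hausdorff_dim {V. hausdorff_dim (proj_line V ` X) \<le> ennreal u} \<le> ennreal (2 * u - s)"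
proof (rule hausdorff_dim_le_limit[where T = 1])
  show "2 * u - s < 1" using us s by linarith
qed (use su hausdorff_measure_exceptional_eq_0 in simp_all)

end

lemma exists_sharp_example:
  fixes s u :: real
  assumes "0 < s" "s \<le> 1" "u < s" "s \<le> 2 * u"
  shows "\<exists>X :: (real^2) set. compact X \<and> hausdorff_dim X = ennreal s \<and>
    hausdorff_dim {V :: G21. hausdorff_dim (proj_line V ` X) \<le> ennreal u} = ennreal (2 * u - s)"
proof -
  \<comment> \<open>One sequence should satisfy the starting condition for both exponents s - u and
    2 u - s. If s = 2 u, the second exponent is 0 and the condition is only imposed for the first;
    the lower bound for the exceptional set is then trivial.\<close>
  define c where "c = (if s = 2 * u then s - u else min (s - u) (2 * u - s))"
  have c: "0 < c" "c \<le> s - u" "s = 2 * u \<or> c \<le> 2 * u - s"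
    using assms by (auto simp: c_def)
  obtain m where m: "strict_mono m" "\<And>j. real (m j) + 1 \<le> c * real (m (Suc j))"
    "\<And>\<epsilon> C. 0 < \<epsilon> \<Longrightarrow> \<forall>\<^sub>F j in sequentially. C * real (m j) + C \<le> \<epsilon> * real (m (Suc j))"
    using exists_sparse_scales[OF c(1)] by blast
  have scales: "real (m j) + 1 \<le> c' * real (m (Suc j))" if "c \<le> c'" for c' j
    using m(2)[of j] mult_right_mono[OF that, of "real (m (Suc j))"] by simp
  interpret sharp_example m s u
  proof
    show "\<forall>\<^sub>F j in sequentially. C * real (m j) + C \<le> \<epsilon> * real (m (Suc j))" if "0 < \<epsilon>" for \<epsilon> C
      using m(3)[OF that] .
  qed (use assms m(1) scales[OF c(2)] in blast)+
  have "ennreal (2 * u - s) \<le> hausdorff_dim {V. hausdorff_dim (proj_line V ` X) \<le> ennreal u}"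
  proof (cases "s = 2 * u")
    case False
    then show ?thesis using c(3) scales by (intro hausdorff_dim_exceptional_ge) auto
  qed simp
  then show ?thesis
    using hausdorff_dim_exceptional_le hausdorff_dim_X_le hausdorff_dim_X_ge
    by (intro exI[of _ X] conjI antisym compact_plane_set compact_gap_cantor)
qed

text \<open>For \<open>u < s / 2\<close> the example for \<open>u = s / 2\<close> already has exceptional directions of dimension 0.\<close>

theorem lemma3p1:
  fixes s u :: real
  assumes "0 < s" and "s \<le> 1" and "0 < u" and "u < s"
  shows "\<exists>X :: (real^2) set. compact X \<and> hausdorff_dim X = ennreal s \<and>
    hausdorff_dim {V :: G21. hausdorff_dim (proj_line V ` X) \<le> ennreal u} = ennreal (max 0 (2 * u - s))"
proof (cases "s \<le> 2 * u")
  case True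
  then show ?thesis using exists_sharp_example[of s u] assms by simp
next
  case False
  obtain X :: "(real^2) set" where X: "compact X" "hausdorff_dim X = ennreal s"
      "hausdorff_dim {V :: G21. hausdorff_dim (proj_line V ` X) \<le> ennreal (s / 2)} = ennreal (2 * (s / 2) - s)"
    using exists_sharp_example[of s "s / 2"] assms by auto
  have "{V :: G21. hausdorff_dim (proj_line V ` X) \<le> ennreal u} \<subseteq> {V. hausdorff_dim (proj_line V ` X) \<le> ennreal (s / 2)}"
    using False by (auto intro: order_trans[OF _ ennreal_leI[of u "s / 2"]])
  from hausdorff_dim_mono[OF this] have "hausdorff_dim {V :: G21. hausdorff_dim (proj_line V ` X) \<le> ennreal u} = 0"
    using X(3) by simp
  then show ?thesis using X False by auto
qed

end
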